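(* Let $d\ge1$ and $r\ge 1$ be integers and let $\mathcal{F}$ be the $r$-colored barycentric subdivision of $(d-1)$-dimensional simplicial complexes. Then its transformation matrix $H_{\mathcal F}$ (a $(d+1)\times(d+1)$ real matrix) is TP$_2$, i.e. all entries and all $2\times2$ minors of $H_{\mathcal F}$ are non-negative.
   Context: Rows and columns of matrices are indexed starting from $0$. All simplicial complexes are finite. For a $(d-1)$-dimensional simplicial complex $\Delta$ with $f_{i-1}$ faces of dimension $i-1$ ($f_{-1}=1$), the $h$-vector $h^\Delta=(h_0,\dots,h_d)$ is defined by $\sum_{i=0}^d h_i x^i=\sum_{i=0}^d f_{i-1}x^i(1-x)^{d-i}$. The barycentric subdivision $\mathrm{sd}(\Delta)$ is the simplicial complex of all chains in the poset of nonempty faces of $\Delta$ ordered by inclusion. For a simplicial complex $\Gamma$ with linearly ordered vertices $v_1<\cdots<v_m$, the $r$-fold edgewise subdivision $\mathrm{esd}_r(\Gamma)$ is the simplicial complex whose vertices are the functions $u:\{v_1,\dots,v_m\}\to\mathbb{Z}_{\ge0}$ with $\sum_i u(v_i)=r$ and $\{v_i:u(v_i)\neq0\}\in\Gamma$; a set $E$ of such functions is a face if the union of their supports is a face of $\Gamma$ and, for all $u,w\in E$, $\iota(u)-\iota(w)\in\{0,1\}^m$ or $\iota(w)-\iota(u)\in\{0,1\}^m$, where $\iota(u)=(u(v_1),u(v_1)+u(v_2),\dots,u(v_1)+\cdots+u(v_m))$. (Its face numbers do not depend on the chosen vertex order.) The $r$-colored barycentric subdivision of $\Delta$ is $\mathrm{esd}_r(\mathrm{sd}(\Delta))$.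 The transformation matrix $H_{\mathcal F}$ is the $(d+1)\times(d+1)$ matrix, depending only on $d$ and $r$, such that $h^{\Delta'}=H_{\mathcal F}\,h^{\Delta}$ (column vectors) for every $(d-1)$-dimensional simplicial complex $\Delta$ with $r$-colored barycentric subdivision $\Delta'$. It is known that, explicitly, the generating polynomial $\sum_{i=0}^d H_{\mathcal F}(i,j)x^i$ of the $j$-th column equals $E_r\big[(1+x+\cdots+x^{r-1})^dP_{d,j}(x)\big]$, where $E_r\big[\sum_{k\ge 0} c_kx^k\big]=\sum_{k\ge 0} c_{rk}x^k$ and $P_{d,j}(x)=\sum_{i=0}^d\Big(\sum_{s=0}^{i}s^j(s+1)^{d-j}(-1)^{i-s}\binom{d+1}{i-s}\Big)x^i$ with $0^0=1$. *)

theory Defs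
  imports
    "HOL-Computational_Algebra.Polynomial"
    "Jordan_Normal_Form.Matrix"
    "Jordan_Normal_Form.Determinant"
    "Jordan_Normal_Form.DL_Submatrix"
begin

section \<open>Finite abstract simplicial complexes\<close>

text \<open>A complex is given by its set of faces; the empty face is always one of them,
  so that \<open>f\<^sub>-\<^sub>1 = 1\<close>.\<close>

definition simplicial_complex :: "'a set set \<Rightarrow> bool" where
  "simplicial_complex \<Delta> \<longleftrightarrow>
     finite \<Delta> \<and> {} \<in> \<Delta> \<and> (\<forall>F\<in>\<Delta>. finite F) \<and> (\<forall>F\<in>\<Delta>. \<forall>G. G \<subseteq> F \<longrightarrow> G \<in> \<Delta>)"

definition complex_dim :: "'a set set \<Rightarrow> int" where
  "complex_dim \<Delta> = int (Max (card ` \<Delta>)) - 1"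

definition face_count :: "'a set set \<Rightarrow> nat \<Rightarrow> nat" where
  "face_count \<Delta> i = card {F \<in> \<Delta>. card F = i}"
  \<comment> \<open>indexed by cardinality: \<open>face_count \<Delta> i = f\<^sub>i\<^sub>-\<^sub>1\<close>\<close>

definition h_poly :: "'a set set \<Rightarrow> real poly" where
  "h_poly \<Delta> = (let d = nat (complex_dim \<Delta> + 1) in
     \<Sum>i\<le>d. of_nat (face_count \<Delta> i) * monom 1 i * [:1, -1:] ^ (d - i))"

definition h_vector :: "'a set set \<Rightarrow> real vec" where
  "h_vector \<Delta> = vec (nat (complex_dim \<Delta> + 1) + 1) (\<lambda>i. coeff (h_poly \<Delta>) i)"

section \<open>Subdivisions\<close>

definition sd :: "'a set set \<Rightarrow> 'a set set set" where
  "sd \<Delta> = chains (\<Delta> - {{}})"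

text \<open>A linear order \<open>v\<^sub>1 < \<dots> < v\<^sub>m\<close> on the vertices of \<open>\<Gamma>\<close> is given by the duplicate-free
  list \<open>vs = [v\<^sub>1, \<dots>, v\<^sub>m]\<close>. A function on the vertices is represented by its extension by
  zero to the whole type; this is enforced by requiring the support to be a face. List
  positions start at zero, so \<open>esd_iota vs u i\<close> is the partial sum up to and including
  \<open>vs ! i\<close>.\<close>

definition supp :: "('a \<Rightarrow> nat) \<Rightarrow> 'a set" where
  "supp u = {v. u v \<noteq> 0}"

definition esd_iota :: "'a list \<Rightarrow> ('a \<Rightarrow> nat) \<Rightarrow> nat \<Rightarrow> int" where
  "esd_iota vs u i = (\<Sum>k\<le>i. int (u (vs ! k)))"

definition esd_vertices :: "nat \<Rightarrow> 'a list \<Rightarrow> 'a set set \<Rightarrow> ('a \<Rightarrow> nat) set" where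
  "esd_vertices r vs \<Gamma> = {u. (\<Sum>v\<in>set vs. u v) = r \<and> supp u \<in> \<Gamma>}"

definition esd :: "nat \<Rightarrow> 'a list \<Rightarrow> 'a set set \<Rightarrow> ('a \<Rightarrow> nat) set set" where
  "esd r vs \<Gamma> = {E. E \<subseteq> esd_vertices r vs \<Gamma> \<and> (\<Union>u\<in>E. supp u) \<in> \<Gamma> \<and>
     (\<forall>u\<in>E. \<forall>w\<in>E.
        (\<forall>i<length vs. esd_iota vs u i - esd_iota vs w i \<in> {0, 1}) \<or>
        (\<forall>i<length vs. esd_iota vs w i - esd_iota vs u i \<in> {0, 1}))}"

definition colored_barycentric ::
  "nat \<Rightarrow> 'a set set \<Rightarrow> ('a set \<Rightarrow> nat) set set \<Rightarrow> bool" where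
  "colored_barycentric r \<Delta> \<Delta>' \<longleftrightarrow>
     (\<exists>vs. distinct vs \<and> set vs = \<Union> (sd \<Delta>) \<and> \<Delta>' = esd r vs (sd \<Delta>))"
  \<comment> \<open>a relation, since the subdivision depends on the chosen order of the vertices\<close>

section \<open>Transformation matrices and total positivity\<close>

text \<open>A subdivision procedure is a relation between complexes and their subdivisions.
  Every finite complex is isomorphic to one with vertices in \<open>\<nat>\<close>, so it suffices to let
  \<open>\<Delta>\<close> range over the latter.\<close>

definition is_transformation_matrix ::
  "nat \<Rightarrow> (nat set set \<Rightarrow> 'b set set \<Rightarrow> bool) \<Rightarrow> real mat \<Rightarrow> bool" where
  "is_transformation_matrix d \<F> H \<longleftrightarrow>
     H \<in> carrier_mat (d + 1) (d + 1) \<and>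
     (\<forall>\<Delta> \<Delta>'. simplicial_complex \<Delta> \<and> complex_dim \<Delta> = int d - 1 \<and> \<F> \<Delta> \<Delta>'
        \<longrightarrow> h_vector \<Delta>' = H *\<^sub>v h_vector \<Delta>)"

definition transformation_matrix ::
  "nat \<Rightarrow> (nat set set \<Rightarrow> 'b set set \<Rightarrow> bool) \<Rightarrow> real mat" where
  "transformation_matrix d \<F> = (THE H. is_transformation_matrix d \<F> H)"

definition TP :: "nat \<Rightarrow> real mat \<Rightarrow> bool" where
  "TP k A \<longleftrightarrow> (\<forall>I J. I \<subseteq> {..<dim_row A} \<and> J \<subseteq> {..<dim_col A} \<and>
     card I = card J \<and> 1 \<le> card I \<and> card I \<le> k \<longrightarrow> det (submatrix A I J) \<ge> 0)"

end

theory Submission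
  imports Defs "HOL-Computational_Algebra.Polynomial_FPS"
begin

text \<open>
  The \<open>h\<close>-polynomial of a complex \<open>\<Gamma>\<close> of rank \<open>d\<close> is \<open>(1 - x)\<^sup>d\<close> times the Hilbert series of its
  Stanley--Reisner ring. Summing up the pieces identifies the monomials of degree \<open>n\<close> of the
  edgewise subdivision with the monomials of degree \<open>r n\<close> of \<open>\<Gamma>\<close>. The monomials of \<open>sd \<Delta>\<close> are
  the multichains of nonempty faces, and there are \<open>\<Sum>\<^bsub>F\<in>\<Delta>\<^esub> n\<^bsup>card F\<^esup>\<close> multichains of length \<open>n\<close> if the
  empty face is allowed as well. This yields the explicit form of the transformation matrix; it is
  unique since the \<open>h\<close>-polynomials \<open>1 + (1 - x)\<^bsup>d-k\<^esup> - (1 - x)\<^sup>d\<close> of two disjoint simplices span.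

  The matrix arises from the matrix of the polynomials \<open>P\<^bsub>d,j\<^esub>\<close> by multiplying \<open>d\<close> times with the
  banded 0-1 matrix of \<open>1 + x + \<dots> + x\<^bsup>r-1\<^esup>\<close> and selecting rows. All these steps preserve
  \<open>TP\<^sub>2\<close> by the Cauchy--Binet formula. The columns \<open>P\<^bsub>d,0\<^esub>, \<dots>, P\<^bsub>d,d\<^esub>, x P\<^bsub>d,0\<^esub>, \<dots>, x P\<^bsub>d,d\<^esub>, x\<^sup>2 P\<^bsub>d,0\<^esub>, \<dots>\<close>
  are in turn obtained, by induction on \<open>d\<close>, from the identity matrix by taking sums over
  windows of consecutive columns and repeating columns, which again preserves \<open>TP\<^sub>2\<close>.
\<close>

section \<open>Matrices with nonnegative entries and minors of size two\<close>

text \<open>Infinite index sets let power series act as matrix columns without dimension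
  bookkeeping. Equal indices are allowed since such minors vanish.\<close>

definition tp2 :: "(nat \<Rightarrow> nat \<Rightarrow> real) \<Rightarrow> bool" where
  "tp2 A \<longleftrightarrow> (\<forall>i j. 0 \<le> A i j) \<and>
     (\<forall>i i' j j'. i \<le> i' \<longrightarrow> j \<le> j' \<longrightarrow> A i j' * A i' j \<le> A i j * A i' j')"

lemma tp2_nonneg: "tp2 A \<Longrightarrow> 0 \<le> A i j"
  by (simp add: tp2_def)

lemma tp2_minor: "tp2 A \<Longrightarrow> i \<le> i' \<Longrightarrow> j \<le> j' \<Longrightarrow> A i j' * A i' j \<le> A i j * A i' j'"
  by (simp add: tp2_def)

text \<open>Repeated rows or columns only create vanishing minors, so weakly monotone maps
  suffice.\<close>

lemma tp2_reindex:
  assumes "tp2 A" "mono f" "mono g"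
  shows "tp2 (\<lambda>i j. A (f i) (g j))"
  using assms by (simp add: tp2_def mono_def)

text \<open>If both antidiagonal entries of a minor are 1, so are the diagonal ones, because both
  ends of the window move weakly upwards with \<open>k\<close>.\<close>

lemma tp2_band: "tp2 (\<lambda>l k. of_bool (f k \<le> l \<and> l < f k + n))" if "mono f"
  using that by (fastforce simp: tp2_def mono_def)

lemma tp2_band_transpose: "tp2 (\<lambda>i k. of_bool (k \<le> i \<and> i < k + n))"
  using tp2_band[of "\<lambda>k. k" n] by (simp add: mono_def)

text \<open>Cauchy--Binet, symmetrised over the two summation indices so that every summand is a
  product of two minors.\<close>

lemma cauchy_binet_2:
  fixes a b c e :: "nat \<Rightarrow> real"
  shows "2 * ((\<Sum>k<n. a k * c k) * (\<Sum>k<n. b k * e k) - (\<Sum>k<n. a k * e k) * (\<Sum>k<n. b k * c k))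
    = (\<Sum>k<n. \<Sum>l<n. (a k * b l - a l * b k) * (c k * e l - c l * e k))"
proof -
  have "(\<Sum>k<n. \<Sum>l<n. (a k * b l - a l * b k) * (c k * e l - c l * e k))
     = (\<Sum>k<n. \<Sum>l<n. (a k * c k) * (b l * e l)) - (\<Sum>k<n. \<Sum>l<n. (a k * e k) * (b l * c l))
      - (\<Sum>k<n. \<Sum>l<n. (b k * c k) * (a l * e l)) + (\<Sum>k<n. \<Sum>l<n. (b k * e k) * (a l * c l))"
    by (simp add: sum_subtractf [symmetric] sum.distrib [symmetric]) (simp add: algebra_simps)
  then show ?thesis
    by (simp add: sum_product [symmetric])
qed

text \<open>A minor of the product is a sum of products of minors. The entries of \<open>M\<close>
  are given by eventually valid finite sums, so that one cutoff \<open>n\<close> serves all four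
  entries of a minor.\<close>

lemma tp2_mult:
  assumes A: "tp2 A" and B: "tp2 B"
    and M: "\<And>i j. \<forall>\<^sub>F n in sequentially. M i j = (\<Sum>k<n. A i k * B k j)"
  shows "tp2 M"
  unfolding tp2_def
proof (intro conjI allI impI)
  fix i j
  from M[of i j] obtain n where "M i j = (\<Sum>k<n. A i k * B k j)"
    by (auto simp: eventually_sequentially)
  then show "0 \<le> M i j"
    by (simp add: sum_nonneg tp2_nonneg A B)
next
  fix i i' j j' :: nat
  assume le: "i \<le> i'" "j \<le> j'"
  have "\<forall>\<^sub>F n in sequentially. M i j = (\<Sum>k<n. A i k * B k j) \<and> M i j' = (\<Sum>k<n. A i k * B k j')
     \<and> M i' j = (\<Sum>k<n. A i' k * B k j) \<and> M i' j' = (\<Sum>k<n. A i' k * B k j')"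
    by (intro eventually_conj M)
  then obtain n where n: "M i j = (\<Sum>k<n. A i k * B k j)" "M i j' = (\<Sum>k<n. A i k * B k j')"
    "M i' j = (\<Sum>k<n. A i' k * B k j)" "M i' j' = (\<Sum>k<n. A i' k * B k j')"
    by (auto simp: eventually_sequentially)
  \<comment> \<open>Swapping \<open>k\<close> and \<open>l\<close> changes the sign of both
    factors.\<close>
  have "0 \<le> (A i k * A i' l - A i l * A i' k) * (B k j * B l j' - B l j * B k j')" for k l
  proof (cases "k \<le> l")
    case True
    then show ?thesis
      using tp2_minor[OF A le(1) True] tp2_minor[OF B True le(2)]
      by (intro mult_nonneg_nonneg) (simp_all add: mult.commute)
  next
    case False
    then have "l \<le> k" by simp
    then show ?thesis
      using tp2_minor[OF A le(1) \<open>l \<le> k\<close>] tp2_minor[OF B \<open>l \<le> k\<close> le(2)]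
      by (intro mult_nonpos_nonpos) (simp_all add: mult.commute)
  qed
  then have "0 \<le> 2 * (M i j * M i' j' - M i j' * M i' j)"
    unfolding n cauchy_binet_2 by (intro sum_nonneg) simp
  then show "M i j' * M i' j \<le> M i j * M i' j'"
    by simp
qed

section \<open>From minors to determinants of submatrices\<close>

lemma det_2:
  assumes A: "A \<in> carrier_mat 2 2"
  shows "det A = A $$ (0,0) * A $$ (1,1) - A $$ (0,1) * A $$ (1,0)"
proof -
  have "det (mat_delete A i 0) = mat_delete A i 0 $$ (0, 0)" for i
    using mat_delete_carrier[OF A, of i 0] by (intro det_single) simp
  then show ?thesis
    using A by (subst laplace_expansion_column[OF A, of 0])
      (simp_all add: cofactor_def numeral_2_eq_2 mat_delete_def)
qed

text \<open>\<open>pick\<close> enumerates \<open>I\<close> and \<open>J\<close> increasingly, so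
  the determinants in question are entries or ordered minors of \<open>A\<close>.\<close>

lemma TP_2_mat:
  assumes "tp2 A"
  shows "TP 2 (mat m n (\<lambda>(i, j). A i j))"
  unfolding TP_def
proof (intro allI impI, elim conjE)
  fix I J
  let ?M = "mat m n (\<lambda>(i, j). A i j)"
  assume I: "I \<subseteq> {..<dim_row ?M}" and J: "J \<subseteq> {..<dim_col ?M}"
    and c: "card I = card J" "1 \<le> card I" "card I \<le> 2"
  have eqI: "{i. i < dim_row ?M \<and> i \<in> I} = I" and eqJ: "{j. j < dim_col ?M \<and> j \<in> J} = J"
    using I J by auto
  have inI: "pick I k < m" if "k < card I" for k
    using pick_in_set_le[OF that] I by auto
  have inJ: "pick J k < n" if "k < card J" for k
    using pick_in_set_le[OF that] J by auto
  have dim: "submatrix ?M I J \<in> carrier_mat (card I) (card J)"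
    by (rule carrier_matI) (simp_all only: dim_submatrix eqI eqJ)
  have entry: "submatrix ?M I J $$ (k, l) = A (pick I k) (pick J l)"
    if "k < card I" "l < card J" for k l
    using that inI inJ submatrix_index[of k ?M I l J] by (simp only: eqI eqJ index_mat) simp
  consider "card I = 1" | "card I = 2"
    using c by linarith
  then show "0 \<le> det (submatrix ?M I J)"
  proof cases
    case 1
    then show ?thesis
      using dim entry c tp2_nonneg[OF assms] by (simp add: det_single)
  next
    case 2
    then have "det (submatrix ?M I J) = A (pick I 0) (pick J 0) * A (pick I 1) (pick J 1)
        - A (pick I 0) (pick J 1) * A (pick I 1) (pick J 0)"
      using dim entry c by (subst det_2) auto
    moreover have "pick I 0 \<le> pick I 1" "pick J 0 \<le> pick J 1"
      using 2 c by (simp_all only: less_imp_le[OF pick_mono_le])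
    ultimately show ?thesis
      using tp2_minor[OF assms] by simp
  qed
qed

section \<open>The columns of the transformation matrix\<close>

abbreviation one_minus_X :: "real fps" where
  "one_minus_X \<equiv> 1 - fps_X"

text \<open>For \<open>j \<le> d\<close>, \<open>bary_column d j\<close> is the polynomial \<open>P\<^bsub>d,j\<^esub>\<close> of the barycentric subdivision
  (lemma \<open>bary_column_eq\<close>). The sequence is continued by \<open>P\<^bsub>d,k+d+1\<^esub> = x P\<^bsub>d,k\<^esub>\<close>, which turns the
  known recursion \<open>P\<^bsub>d+1,j\<^esub> = x \<Sum>\<^bsub>l<j\<^esub> P\<^bsub>d,l\<^esub> + \<Sum>\<^bsub>j\<le>l\<le>d\<^esub> P\<^bsub>d,l\<^esub>\<close> into a sum over a window of \<open>d + 1\<close>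
  consecutive columns. The window position is \<open>k - k div (d + 2)\<close> because the last
  window of a period is also the first one of the next.\<close>

fun bary_column :: "nat \<Rightarrow> nat \<Rightarrow> real fps" where
  "bary_column 0 k = fps_X ^ k"
| "bary_column (Suc d) k = (\<Sum>l<Suc d. bary_column d (k - k div (d + 2) + l))"

lemma sum_window: "(\<Sum>l\<in>{m..<m + n}. f l) = (\<Sum>l<n. f (m + l))" for m n :: nat
  by (rule sum.reindex_bij_witness[of _ "\<lambda>l. m + l" "\<lambda>l. l - m"]) auto

text \<open>The quotient grows by at most one when \<open>k\<close> grows by one.\<close>

lemma mono_diff_div: "mono (\<lambda>k::nat. k - k div (d + 2))"
  by (rule mono_iff_le_Suc[THEN iffD2]) (auto simp: div_Suc)

text \<open>At level 0 the columns \<open>x^k\<close> form the identity matrix. Each further level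
  is a product with the band matrix whose windows have length \<open>Suc d\<close> and start at
  \<open>k - k div (d + 2)\<close>.\<close>

lemma tp2_bary_column: "tp2 (\<lambda>i k. fps_nth (bary_column d k) i)"
proof (induction d)
  case 0
  then show ?case
    by (auto simp: tp2_def)
next
  case (Suc d)
  let ?f = "\<lambda>k. k - k div (d + 2)"
  show ?case
  proof (rule tp2_mult[OF Suc.IH tp2_band[OF mono_diff_div, of d "Suc d"]])
    fix i k
    have "(\<Sum>l<n. fps_nth (bary_column d l) i * of_bool (?f k \<le> l \<and> l < ?f k + Suc d))
        = fps_nth (bary_column (Suc d) k) i" if "n \<ge> ?f k + Suc d" for n
    proof -
      have "(\<Sum>l<n. fps_nth (bary_column d l) i * of_bool (?f k \<le> l \<and> l < ?f k + Suc d))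
          = (\<Sum>l\<in>{?f k..<?f k + Suc d}. fps_nth (bary_column d l) i)"
        using that by (intro sum.mono_neutral_cong_right) auto
      also have "\<dots> = (\<Sum>l<Suc d. fps_nth (bary_column d (?f k + l)) i)"
        by (rule sum_window)
      finally show ?thesis
        by (simp add: fps_sum_nth)
    qed
    then show "\<forall>\<^sub>F n in sequentially. fps_nth (bary_column (Suc d) k) i =
        (\<Sum>l<n. fps_nth (bary_column d l) i * of_bool (?f k \<le> l \<and> l < ?f k + Suc d))"
      unfolding eventually_sequentially by (intro exI[of _ "?f k + Suc d"]) auto
  qed
qed

text \<open>One period \<open>d + 2\<close> of level \<open>Suc d\<close> raises the quotient by 1
  and thus moves the window by \<open>d + 1\<close>, one period of level \<open>d\<close>.\<close>

lemma bary_column_shift: "bary_column d (k + Suc d) = fps_X * bary_column d k"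
proof (induction d arbitrary: k)
  case (Suc d)
  have "(k + Suc (Suc d)) div (d + 2) = Suc (k div (d + 2))"
    using div_add_self2[of "d + 2" k] by simp
  then have "(k + Suc (Suc d)) - (k + Suc (Suc d)) div (d + 2) + l
      = (k - k div (d + 2) + l) + Suc d" for l
    using div_le_dividend[of k "d + 2"] by linarith
  then show ?case
    by (simp only: bary_column.simps Suc.IH sum_distrib_left)
qed simp

section \<open>Generating series of the columns\<close>

text \<open>For \<open>j \<le> d\<close>, \<open>P_{d,j}\<close> is \<open>(1 - x)^(d+1)\<close>
  times this series; \<open>0 ^ 0 = 1\<close> gives the constant term 1 when
  \<open>j = 0\<close>.\<close>

definition bary_series :: "nat \<Rightarrow> nat \<Rightarrow> real fps" where
  "bary_series d j = Abs_fps (\<lambda>s. of_nat s ^ j * (of_nat s + 1) ^ (d - j))"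

text \<open>For \<open>s > 0\<close> the coefficient of \<open>x^s\<close> on the left is
  \<open>s^j (s+1)^(d+1-j) - (s-1)^j s^(d+1-j)\<close>. Inserting \<open>s^(d+1)\<close> splits it
  into two differences of powers that factor into sums: \<open>up\<close> at \<open>s\<close> and
  \<open>down\<close> at \<open>s - 1\<close>. For \<open>s = 0\<close> only \<open>up\<close>
  remains.\<close>

lemma bary_series_rec:
  assumes "j \<le> Suc d"
  shows "one_minus_X * bary_series (Suc d) j
    = (\<Sum>l\<in>{j..d}. bary_series d l) + fps_X * (\<Sum>l<j. bary_series d l)"
proof (rule fps_ext)
  fix s
  have geometric: "(\<Sum>l<n. (x + 1) ^ (n - Suc l) * x ^ l) = (x + 1) ^ n - x ^ n" for x :: real and n
    using power_diff_sumr2[of x n "x + 1"] by simp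
  have up: "(\<Sum>l\<in>{j..d}. x ^ l * (x + 1) ^ (d - l)) = x ^ j * (x + 1) ^ (Suc d - j) - x ^ Suc d"
    for x :: real
  proof -
    have "(\<Sum>l\<in>{j..d}. x ^ l * (x + 1) ^ (d - l))
        = (\<Sum>l\<in>{..<Suc d - j}. x ^ j * ((x + 1) ^ (Suc d - j - Suc l) * x ^ l))"
      by (rule sum.reindex_bij_witness[of _ "\<lambda>l. j + l" "\<lambda>l. l - j"])
        (auto simp: power_add[symmetric] mult_ac)
    also have "\<dots> = x ^ j * ((x + 1) ^ (Suc d - j) - x ^ (Suc d - j))"
      unfolding sum_distrib_left[symmetric] by (simp only: geometric)
    finally show ?thesis
      using assms by (simp add: right_diff_distrib power_add[symmetric] del: power_Suc)
  qed
  have down: "(\<Sum>l<j. x ^ l * (x + 1) ^ (d - l)) = (x + 1) ^ Suc d - x ^ j * (x + 1) ^ (Suc d - j)"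
    for x :: real
  proof -
    have "(\<Sum>l<j. x ^ l * (x + 1) ^ (d - l))
        = (\<Sum>l<j. (x + 1) ^ (Suc d - j) * ((x + 1) ^ (j - Suc l) * x ^ l))"
      using assms by (intro sum.cong) (auto simp: power_add[symmetric] mult.assoc[symmetric])
    also have "\<dots> = (x + 1) ^ (Suc d - j) * ((x + 1) ^ j - x ^ j)"
      unfolding sum_distrib_left[symmetric] by (simp only: geometric)
    finally show ?thesis
      using assms by (simp add: right_diff_distrib power_add[symmetric] mult.commute del: power_Suc)
  qed
  show "fps_nth (one_minus_X * bary_series (Suc d) j) s
    = fps_nth ((\<Sum>l\<in>{j..d}. bary_series d l) + fps_X * (\<Sum>l<j. bary_series d l)) s"
  proof (cases s)
    case 0
    then show ?thesis
      using up[of 0] by (simp add: bary_series_def left_diff_distrib fps_sum_nth)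
  next
    case (Suc t)
    have "of_nat s = (of_nat t + 1 :: real)"
      using Suc by simp
    then show ?thesis
      using up[of "of_nat s"] down[of "of_nat t"]
      by (simp add: bary_series_def left_diff_distrib fps_sum_nth Suc add_ac del: power_Suc)
  qed
qed

text \<open>For these \<open>j\<close> the quotient in the window position is 0, so the window
  starts at \<open>j\<close>. Its columns beyond the last polynomial one are \<open>x\<close> times
  the first \<open>j\<close>, which reproduces the recursion of
  \<open>bary_series_rec\<close>.\<close>

lemma bary_column_eq:
  "j \<le> d \<Longrightarrow> bary_column d j = one_minus_X ^ Suc d * bary_series d j"
proof (induction d arbitrary: j)
  case 0
  have "one_minus_X * bary_series 0 0 = 1"
    by (rule fps_ext) (simp add: bary_series_def left_diff_distrib)
  with 0 show ?case by simp
next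
  case (Suc d)
  have "(\<Sum>l<Suc d. bary_column d (j + l)) = (\<Sum>l\<in>{j..<j + Suc d}. bary_column d l)"
    by (rule sum_window [symmetric])
  also have "{j..<j + Suc d} = {j..d} \<union> {Suc d..<j + Suc d}"
    using Suc.prems by auto
  also have "(\<Sum>l\<in>\<dots>. bary_column d l)
      = (\<Sum>l\<in>{j..d}. bary_column d l) + (\<Sum>l\<in>{Suc d..<j + Suc d}. bary_column d l)"
    by (intro sum.union_disjoint) auto
  also have "(\<Sum>l\<in>{Suc d..<j + Suc d}. bary_column d l) = (\<Sum>l<j. bary_column d (l + Suc d))"
    by (rule sum.reindex_bij_witness[of _ "\<lambda>l. l + Suc d" "\<lambda>l. l - Suc d"]) auto
  also have "\<dots> = fps_X * (\<Sum>l<j. bary_column d l)"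
    by (simp only: bary_column_shift sum_distrib_left)
  also have "(\<Sum>l<j. bary_column d l) = one_minus_X ^ Suc d * (\<Sum>l<j. bary_series d l)"
    using Suc.prems by (simp only: sum_distrib_left) (intro sum.cong Suc.IH, auto)
  also have "(\<Sum>l\<in>{j..d}. bary_column d l) = one_minus_X ^ Suc d * (\<Sum>l\<in>{j..d}. bary_series d l)"
    by (simp only: sum_distrib_left) (intro sum.cong Suc.IH, auto)
  also have "one_minus_X ^ Suc d * (\<Sum>l\<in>{j..d}. bary_series d l)
      + fps_X * (one_minus_X ^ Suc d * (\<Sum>l<j. bary_series d l))
     = one_minus_X ^ Suc d * ((\<Sum>l\<in>{j..d}. bary_series d l) + fps_X * (\<Sum>l<j. bary_series d l))"
    by (simp add: algebra_simps)
  also have "\<dots> = one_minus_X ^ Suc (Suc d) * bary_series (Suc d) j"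
    unfolding bary_series_rec[OF Suc.prems, symmetric] by (simp add: mult_ac)
  finally show ?case
    using Suc.prems by simp
qed

section \<open>Multiplication by \<open>1 + x + ... + x^(r-1)\<close> and selection of every
  \<open>r\<close>-th row\<close>

text \<open>On coefficient columns this multiplication is a band matrix, with ones in row
  \<open>i\<close> where \<open>k \<le> i < k + r\<close>.\<close>

lemma tp2_window_mult:
  assumes "tp2 (\<lambda>i j. fps_nth (f j) i)"
  shows "tp2 (\<lambda>i j. fps_nth ((\<Sum>l<r. fps_X ^ l) * f j) i)"
proof (rule tp2_mult[OF tp2_band_transpose[of r] assms])
  fix i j
  have "fps_nth ((\<Sum>l<r. fps_X ^ l) * f j) i
      = (\<Sum>k<n. of_bool (k \<le> i \<and> i < k + r) * fps_nth (f j) k)" if "n > i" for n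
  proof -
    have "fps_nth ((\<Sum>l<r. fps_X ^ l) * f j) i = (\<Sum>l<r. if i < l then 0 else fps_nth (f j) (i - l))"
      by (simp add: sum_distrib_right fps_sum_nth fps_X_power_mult_nth)
    also have "\<dots> = (\<Sum>l\<in>{l. l < r \<and> l \<le> i}. fps_nth (f j) (i - l))"
      by (intro sum.mono_neutral_cong_right) auto
    also have "\<dots> = (\<Sum>k\<in>{k. k \<le> i \<and> i < k + r}. fps_nth (f j) k)"
      by (rule sum.reindex_bij_witness[of _ "\<lambda>k. i - k" "\<lambda>l. i - l"]) auto
    also have "\<dots> = (\<Sum>k<n. of_bool (k \<le> i \<and> i < k + r) * fps_nth (f j) k)"
      using that by (intro sum.mono_neutral_cong_left) auto
    finally show ?thesis .
  qed
  then show "\<forall>\<^sub>F n in sequentially. fps_nth ((\<Sum>l<r. fps_X ^ l) * f j) i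
      = (\<Sum>k<n. of_bool (k \<le> i \<and> i < k + r) * fps_nth (f j) k)"
    unfolding eventually_sequentially by (intro exI[of _ "Suc i"]) auto
qed

lemma tp2_window_power_mult:
  assumes "tp2 (\<lambda>i j. fps_nth (f j) i)"
  shows "tp2 (\<lambda>i j. fps_nth ((\<Sum>l<r. fps_X ^ l) ^ n * f j) i)"
proof (induction n)
  case (Suc n)
  then show ?case
    using tp2_window_mult[OF Suc] by (simp add: mult.assoc)
qed (simp add: assms)

text \<open>For \<open>j \<le> d\<close>, the coefficient of \<open>x^i\<close> in
  \<open>E_r[(1 + ... + x^(r-1))^d P_{d,j}]\<close>; reading at \<open>r * i\<close> performs
  \<open>E_r\<close>.\<close>

definition H_entry :: "nat \<Rightarrow> nat \<Rightarrow> nat \<Rightarrow> nat \<Rightarrow> real" where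
  "H_entry d r i j = fps_nth ((\<Sum>l<r. fps_X ^ l) ^ d * bary_column d j) (r * i)"

lemma tp2_H_entry: "tp2 (H_entry d r)"
  unfolding H_entry_def
  by (rule tp2_reindex[OF tp2_window_power_mult[OF tp2_bary_column]]) (auto simp: mono_def)

text \<open>A factor \<open>1 - x\<close> outside the section is a factor
  \<open>1 - x^r = (1 + ... + x^(r-1)) (1 - x)\<close> inside it. The factors move one at a time, so
  \<open>S\<close> varies in the induction.\<close>

lemma sections_mult:
  fixes S :: "real fps"
  assumes "r \<ge> 1"
  shows "one_minus_X ^ d * Abs_fps (\<lambda>n. fps_nth S (r * n))
    = Abs_fps (\<lambda>n. fps_nth ((\<Sum>l<r. fps_X ^ l) ^ d * (one_minus_X ^ d * S)) (r * n))"
proof (induction d arbitrary: S)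
  case (Suc d)
  let ?w = "\<Sum>l<r. fps_X ^ l :: real fps"
  have geo: "?w * one_minus_X = 1 - fps_X ^ r"
    by (simp add: one_diff_power_eq mult.commute)
  have "one_minus_X * Abs_fps (\<lambda>n. fps_nth S (r * n))
      = Abs_fps (\<lambda>n. fps_nth ((?w * one_minus_X) * S) (r * n))"
    unfolding geo
    using assms
    by (intro fps_ext) (auto simp: left_diff_distrib fps_X_power_mult_nth right_diff_distrib')
  then have "one_minus_X ^ Suc d * Abs_fps (\<lambda>n. fps_nth S (r * n))
     = one_minus_X ^ d * Abs_fps (\<lambda>n. fps_nth ((?w * one_minus_X) * S) (r * n))"
    by (simp add: mult_ac)
  also have "\<dots> = Abs_fps (\<lambda>n. fps_nth (?w ^ d * (one_minus_X ^ d * ((?w * one_minus_X) * S))) (r * n))"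
    by (rule Suc.IH)
  finally show ?case
    by (simp add: mult_ac)
qed simp

section \<open>Hilbert series and the \<open>h\<close>-polynomial\<close>

text \<open>The monomials of degree \<open>n\<close> that are nonzero in the Stanley--Reisner ring of \<open>\<Gamma>\<close>, as
  multisets of vertices.\<close>

definition monomials :: "'a set set \<Rightarrow> nat \<Rightarrow> 'a multiset set" where
  "monomials \<Gamma> n = {M. size M = n \<and> set_mset M \<in> \<Gamma>}"

lemma finite_mset_size: "finite A \<Longrightarrow> finite {M. size M = n \<and> set_mset M \<subseteq> A}"
  using finite_multisets_of_size[of A n] by (simp only: multisets_of_size_def conj_commute)

lemma finite_monomials:
  assumes "simplicial_complex \<Gamma>"
  shows "finite (monomials \<Gamma> n)"
proof -
  have "finite (\<Union>\<Gamma>)"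
    using assms by (auto simp: simplicial_complex_def)
  from finite_mset_size[OF this, of n] show ?thesis
    by (rule rev_finite_subset) (auto simp: monomials_def)
qed

lemma inj_on_add_mset: "inj_on (add_mset v) A"
  by (simp add: inj_on_def)

text \<open>Removing one copy of \<open>v\<close> leaves a multiset that either has lost
  \<open>v\<close> or still contains it.\<close>

lemma card_mset_with_support_Suc:
  assumes "finite F" "v \<notin> F"
  shows "card {M. size M = Suc n \<and> set_mset M = insert v F}
    = card {M. size M = n \<and> set_mset M = F} + card {M. size M = n \<and> set_mset M = insert v F}"
proof -
  let ?S = "\<lambda>n A. {M. size M = n \<and> set_mset M = A}"
  have fin: "finite (?S k A)" if "finite A" for k and A :: "'a set"
    using finite_mset_size[OF that, of k] by (rule rev_finite_subset) auto
  have "?S (Suc n) (insert v F) = add_mset v ` (?S n F \<union> ?S n (insert v F))"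
  proof (intro equalityI subsetI)
    fix M assume M: "M \<in> ?S (Suc n) (insert v F)"
    then have "v \<in># M" by simp
    then obtain N where N: "M = add_mset v N"
      by (rule mset_add)
    have "N \<in> ?S n F \<union> ?S n (insert v F)"
    proof (cases "v \<in># N")
      case True
      then show ?thesis using M N by (simp add: insert_absorb)
    next
      case False
      then have "set_mset N = F"
        using M N assms insert_ident[of v "set_mset N" F] by simp
      then show ?thesis using M N by simp
    qed
    then show "M \<in> add_mset v ` (?S n F \<union> ?S n (insert v F))"
      unfolding N by (rule imageI)
  next
    fix M assume "M \<in> add_mset v ` (?S n F \<union> ?S n (insert v F))"
    then obtain N where N: "M = add_mset v N" "N \<in> ?S n F \<union> ?S n (insert v F)"
      by (rule imageE)
    from N(2) show "M \<in> ?S (Suc n) (insert v F)"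
      unfolding N(1) by (elim UnE) simp_all
  qed
  then have "card (?S (Suc n) (insert v F)) = card (?S n F \<union> ?S n (insert v F))"
    by (simp only: card_image inj_on_add_mset)
  also have "\<dots> = card (?S n F) + card (?S n (insert v F))"
    using assms(1) by (intro card_Un_disjoint fin) (simp_all, use assms(2) in blast)
  finally show ?thesis .
qed

text \<open>Compositions of \<open>n + 1\<close> into \<open>card F\<close> positive parts; removing
  a copy of one element gives Pascal's rule. This exact count later bounds the growth of
  \<open>monomials\<close>.\<close>

lemma card_mset_with_support:
  assumes "finite F" "F \<noteq> {}"
  shows "card {M. size M = Suc n \<and> set_mset M = F} = n choose (card F - 1)"
  using assms
proof (induction n arbitrary: F)
  case 0
  then obtain v where "v \<in> F"
    by blast
  then obtain G where vG: "F = insert v G" "v \<notin> G"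
    by (rule Set.set_insert)
  have "card {M. size M = 0 \<and> set_mset M = G} = 0 choose card G"
  proof (cases "G = {}")
    case True
    then have "{M. size M = 0 \<and> set_mset M = G} = {{#}}" by auto
    then show ?thesis using True by simp
  next
    case False
    then have "{M. size M = 0 \<and> set_mset M = G} = {}" by auto
    moreover have "0 choose card G = 0"
      using 0 vG False by (intro binomial_eq_0) (simp add: card_gt_0_iff)
    ultimately show ?thesis by (simp only: card.empty)
  qed
  moreover have "{M. size M = 0 \<and> set_mset M = insert v G} = {}"
    by auto
  moreover have "finite G" "card F - 1 = card G"
    using 0 vG by simp_all
  ultimately show ?case
    using card_mset_with_support_Suc[of G v 0] vG by (simp only: card.empty) simp
next
  case (Suc n)
  then obtain v where "v \<in> F"
    by blast
  then obtain G where vG: "F = insert v G" "v \<notin> G"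
    by (rule Set.set_insert)
  show ?case
  proof (cases "G = {}")
    case True
    have "{M. size M = Suc n \<and> set_mset M = {}} = {}"
      by auto
    then show ?thesis
      using Suc.IH[of F] Suc.prems vG True card_mset_with_support_Suc[of G v "Suc n"] by simp
  next
    case False
    then obtain m where "card G = Suc m"
      using vG Suc.prems by (cases "card G") auto
    then show ?thesis
      using Suc.IH[of F] Suc.IH[of G] Suc.prems vG False card_mset_with_support_Suc[of G v "Suc n"]
      by simp
  qed
qed

lemma card_monomials_sum:
  assumes "simplicial_complex \<Gamma>"
  shows "card (monomials \<Gamma> n) = (\<Sum>F\<in>\<Gamma>. card {M. size M = n \<and> set_mset M = F})"
proof -
  have "monomials \<Gamma> n = (\<Union>F\<in>\<Gamma>. {M. size M = n \<and> set_mset M = F})"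
    by (auto simp: monomials_def)
  also have "card \<dots> = (\<Sum>F\<in>\<Gamma>. card {M. size M = n \<and> set_mset M = F})"
  proof (rule card_UN_disjoint)
    show "\<forall>F\<in>\<Gamma>. finite {M. size M = n \<and> set_mset M = F}"
    proof
      fix F assume "F \<in> \<Gamma>"
      then have "finite F" using assms by (auto simp: simplicial_complex_def)
      from finite_mset_size[OF this, of n] show "finite {M. size M = n \<and> set_mset M = F}"
        by (rule rev_finite_subset) auto
    qed
  qed (use assms in \<open>auto simp: simplicial_complex_def\<close>)
  finally show ?thesis .
qed

text \<open>Each vertex of the support contributes \<open>x / (1 - x)\<close>, an exponent of at
  least 1.\<close>

lemma mset_with_support_series:
  assumes "finite F"
  shows "(1 - fps_X) ^ card F * Abs_fps (\<lambda>n. real (card {M. size M = n \<and> set_mset M = F}))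
    = fps_X ^ card F"
  using assms
proof (induction F rule: finite_induct)
  case empty
  have "{M. size M = n \<and> set_mset M = {}} = (if n = 0 then {{#}} else {})" for n
    by auto
  then show ?case
    by (intro fps_ext) (simp add: if_distrib[of card] cong: if_cong)
next
  case (insert v F)
  let ?S = "\<lambda>A. Abs_fps (\<lambda>n. real (card {M. size M = n \<and> set_mset M = A}))"
  have "(1 - fps_X) * ?S (insert v F) = fps_X * ?S F"
  proof (rule fps_ext)
    fix n
    show "fps_nth ((1 - fps_X) * ?S (insert v F)) n = fps_nth (fps_X * ?S F) n"
    proof (cases n)
      case 0
      then show ?thesis by (auto simp: left_diff_distrib)
    next
      case (Suc m)
      then show ?thesis
        using card_mset_with_support_Suc[OF insert.hyps, of m] by (simp add: left_diff_distrib)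
    qed
  qed
  then have "(1 - fps_X) ^ Suc (card F) * ?S (insert v F)
     = fps_X * ((1 - fps_X) ^ card F * ?S F)"
    by (simp add: mult_ac)
  then show ?case
    using insert by simp
qed

section \<open>Rank, and the \<open>h\<close>-polynomial as numerator of the Hilbert series\<close>

definition rank :: "'a set set \<Rightarrow> nat" where
  "rank \<Gamma> = nat (complex_dim \<Gamma> + 1)"

lemma rank_eq_Max: "rank \<Gamma> = Max (card ` \<Gamma>)"
  by (simp add: rank_def complex_dim_def)

lemma card_le_rank: "simplicial_complex \<Gamma> \<Longrightarrow> F \<in> \<Gamma> \<Longrightarrow> card F \<le> rank \<Gamma>"
  by (simp add: rank_eq_Max simplicial_complex_def)

lemma ex_card_rank:
  assumes "simplicial_complex \<Gamma>"
  shows "\<exists>F\<in>\<Gamma>. card F = rank \<Gamma>"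
proof -
  have "rank \<Gamma> \<in> card ` \<Gamma>"
    unfolding rank_eq_Max using assms by (intro Max_in) (auto simp: simplicial_complex_def)
  then show ?thesis
    by (metis imageE)
qed

lemma sum_face_count:
  fixes g :: "nat \<Rightarrow> 'b::comm_semiring_1"
  assumes "simplicial_complex \<Gamma>"
  shows "(\<Sum>i\<le>rank \<Gamma>. of_nat (face_count \<Gamma> i) * g i) = (\<Sum>F\<in>\<Gamma>. g (card F))"
proof -
  have "(\<Sum>F\<in>\<Gamma>. g (card F)) = (\<Sum>i\<le>rank \<Gamma>. \<Sum>F\<in>{F\<in>\<Gamma>. card F = i}. g (card F))"
    using assms card_le_rank[OF assms] by (subst sum.group) (auto simp: simplicial_complex_def)
  also have "\<dots> = (\<Sum>i\<le>rank \<Gamma>. of_nat (face_count \<Gamma> i) * g i)"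
    by (intro sum.cong) (simp_all add: face_count_def)
  finally show ?thesis ..
qed

lemma h_poly_sum_faces:
  assumes "simplicial_complex \<Gamma>"
  shows "h_poly \<Gamma> = (\<Sum>F\<in>\<Gamma>. monom 1 (card F) * [:1, -1:] ^ (rank \<Gamma> - card F))"
  using sum_face_count[OF assms, of "\<lambda>i. monom 1 i * [:1, -1:] ^ (rank \<Gamma> - i)"]
  by (simp add: h_poly_def rank_def Let_def mult.assoc)

lemma fps_of_poly_one_minus_X: "fps_of_poly [:1, -1:] = (1 - fps_X :: real fps)"
  by (simp add: fps_of_poly_linear')

text \<open>Divided by \<open>(1 - x)^rank\<close>, the term of a face \<open>F\<close> becomes
  \<open>(x / (1 - x))^(card F)\<close>, the series of the monomials with support
  \<open>F\<close>.\<close>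

lemma h_poly_series:
  assumes "simplicial_complex \<Gamma>"
  shows "fps_of_poly (h_poly \<Gamma>) = (1 - fps_X) ^ rank \<Gamma> * Abs_fps (\<lambda>n. real (card (monomials \<Gamma> n)))"
proof -
  let ?S = "\<lambda>F. Abs_fps (\<lambda>n. real (card {M. size M = n \<and> set_mset M = F}))"
  have "fps_of_poly (h_poly \<Gamma>) = (\<Sum>F\<in>\<Gamma>. (1 - fps_X) ^ (rank \<Gamma> - card F) * fps_X ^ card F)"
    by (simp add: h_poly_sum_faces[OF assms] fps_of_poly_sum fps_of_poly_mult fps_of_poly_power
        fps_of_poly_monom' fps_of_poly_one_minus_X mult.commute)
  also have "\<dots> = (\<Sum>F\<in>\<Gamma>. (1 - fps_X) ^ rank \<Gamma> * ?S F)"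
  proof (rule sum.cong)
    fix F assume F: "F \<in> \<Gamma>"
    then have "finite F" using assms by (auto simp: simplicial_complex_def)
    moreover have "rank \<Gamma> = rank \<Gamma> - card F + card F"
      using card_le_rank[OF assms F] by simp
    ultimately show "(1 - fps_X) ^ (rank \<Gamma> - card F) * fps_X ^ card F = (1 - fps_X) ^ rank \<Gamma> * ?S F"
      by (subst mset_with_support_series[symmetric]) (simp_all add: mult.assoc[symmetric] power_add[symmetric])
  qed simp
  also have "\<dots> = (1 - fps_X) ^ rank \<Gamma> * (\<Sum>F\<in>\<Gamma>. ?S F)"
    by (simp add: sum_distrib_left)
  also have "(\<Sum>F\<in>\<Gamma>. ?S F) = Abs_fps (\<lambda>n. real (card (monomials \<Gamma> n)))"
    by (rule fps_ext) (simp add: card_monomials_sum[OF assms] fps_sum_nth)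
  finally show ?thesis .
qed

lemma degree_h_poly:
  assumes "simplicial_complex \<Gamma>"
  shows "degree (h_poly \<Gamma>) \<le> rank \<Gamma>"
  unfolding h_poly_sum_faces[OF assms]
proof (rule degree_sum_le)
  show "finite \<Gamma>" using assms by (simp add: simplicial_complex_def)
next
  fix F assume "F \<in> \<Gamma>"
  have "degree (monom 1 (card F) * [:1, -1:] ^ (rank \<Gamma> - card F) :: real poly)
      \<le> card F + (rank \<Gamma> - card F) * 1"
    using degree_mult_le[of "monom 1 (card F)" "[:1, -1:] ^ (rank \<Gamma> - card F) :: real poly"]
      degree_power_le[of "[:1, -1:] :: real poly" "rank \<Gamma> - card F"]
    by (simp add: degree_monom_eq)
  then show "degree (monom 1 (card F) * [:1, -1:] ^ (rank \<Gamma> - card F) :: real poly) \<le> rank \<Gamma>"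
    using card_le_rank[OF assms \<open>F \<in> \<Gamma>\<close>] by simp
qed

text \<open>Evaluation of the \<open>h\<close>-polynomial at \<open>x = n / (n + 1)\<close>, where
  \<open>1 - x = 1 / (n + 1)\<close>, cleared of denominators by \<open>(n + 1)^d\<close>. The
  right-hand side will turn out to count multichains.\<close>

lemma sum_h_poly_coeff:
  assumes "simplicial_complex \<Gamma>" and d: "rank \<Gamma> = d"
  shows "(\<Sum>j\<le>d. coeff (h_poly \<Gamma>) j * (real n ^ j * (real n + 1) ^ (d - j)))
    = (\<Sum>F\<in>\<Gamma>. real n ^ card F)"
proof -
  define x where "x = real n / (real n + 1)"
  have x: "(real n + 1) ^ d * (x ^ i * (1 - x) ^ (d - i)) = real n ^ i"
    and x': "(real n + 1) ^ d * x ^ i = real n ^ i * (real n + 1) ^ (d - i)" if "i \<le> d" for i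
  proof -
    have "1 - x = 1 / (real n + 1)" by (simp add: x_def field_simps)
    moreover have "(real n + 1) ^ d = (real n + 1) ^ i * (real n + 1) ^ (d - i)"
      using that by (simp add: power_add[symmetric])
    ultimately show "(real n + 1) ^ d * (x ^ i * (1 - x) ^ (d - i)) = real n ^ i"
      "(real n + 1) ^ d * x ^ i = real n ^ i * (real n + 1) ^ (d - i)"
      by (simp_all add: x_def power_divide)
  qed
  have "(\<Sum>j\<le>d. coeff (h_poly \<Gamma>) j * (real n ^ j * (real n + 1) ^ (d - j)))
      = (real n + 1) ^ d * (\<Sum>j\<le>d. coeff (h_poly \<Gamma>) j * x ^ j)"
    unfolding sum_distrib_left using x' by (intro sum.cong) (auto simp: mult_ac)
  also have "(\<Sum>j\<le>d. coeff (h_poly \<Gamma>) j * x ^ j) = poly (h_poly \<Gamma>) x"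
    using degree_h_poly[OF assms(1)] d
    by (subst poly_altdef) (intro sum.mono_neutral_right, auto simp: coeff_eq_0)
  also have "\<dots> = (\<Sum>F\<in>\<Gamma>. x ^ card F * (1 - x) ^ (d - card F))"
    by (simp add: h_poly_sum_faces[OF assms(1)] d poly_sum poly_monom)
  also have "(real n + 1) ^ d * \<dots> = (\<Sum>F\<in>\<Gamma>. real n ^ card F)"
    unfolding sum_distrib_left using x card_le_rank[OF assms(1)] d by (intro sum.cong) auto
  finally show ?thesis .
qed

section \<open>Barycentric subdivision\<close>

lemma chains_iff: "C \<in> chains A \<longleftrightarrow> C \<subseteq> A \<and> (\<forall>F\<in>C. \<forall>G\<in>C. F \<subseteq> G \<or> G \<subseteq> F)"
  by (auto simp: chains_def chain_subset_def)

lemma chains_subset: "C \<in> chains A \<Longrightarrow> D \<subseteq> C \<Longrightarrow> D \<subseteq> B \<Longrightarrow> D \<in> chains B"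
  unfolding chains_iff by blast

lemma chains_insert_iff:
  "insert F C \<in> chains A \<longleftrightarrow> F \<in> A \<and> C \<in> chains A \<and> (\<forall>G\<in>C. F \<subseteq> G \<or> G \<subseteq> F)"
  unfolding chains_iff by blast

section \<open>Counting multichains of faces\<close>

lemma sum_power_card_Pow:
  fixes x y :: "'b::comm_semiring_1"
  assumes "finite A"
  shows "(\<Sum>F\<in>Pow A. x ^ card F * y ^ (card A - card F)) = (x + y) ^ card A"
proof -
  have "(x + y) ^ card A = (\<Prod>a\<in>A. x + y)" by simp
  also have "\<dots> = (\<Sum>F\<in>Pow A. (\<Prod>a\<in>F. x) * (\<Prod>a\<in>A - F. y))"
    by (rule prod_add[OF assms])
  also have "\<dots> = (\<Sum>F\<in>Pow A. x ^ card F * y ^ (card A - card F))"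
    using assms by (intro sum.cong) (auto simp: card_Diff_subset finite_subset)
  finally show ?thesis ..
qed

text \<open>In contrast to the monomials of \<open>sd \<Delta>\<close>, the empty face may occur if
  it lies in \<open>S\<close>.\<close>

definition multichains :: "'a set set \<Rightarrow> nat \<Rightarrow> 'a set multiset set" where
  "multichains S n = {M. size M = n \<and> set_mset M \<in> chains S}"

lemma finite_multichains: "finite S \<Longrightarrow> finite (multichains S n)"
  by (rule rev_finite_subset[OF finite_mset_size[of S n]]) (auto simp: multichains_def chains_iff)

lemma multichain_has_top:
  assumes "set_mset M \<in> chains S" "M \<noteq> {#}"
  shows "\<exists>G\<in>#M. \<forall>F\<in>#M. F \<subseteq> G"
proof -
  have "\<Union>(set_mset M) \<in> set_mset M"
    using assms by (intro Union_in_chain) (auto simp: chains_iff subset_chain_def subset.chain_def)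
  then show ?thesis by auto
qed

text \<open>Splitting off the largest member of a multichain of size \<open>n + 1\<close>.\<close>

lemma card_multichains_Suc:
  assumes S: "finite S" "\<And>F G. F \<in> S \<Longrightarrow> G \<subseteq> F \<Longrightarrow> G \<in> S"
    and fin: "\<And>F. F \<in> S \<Longrightarrow> finite F"
  shows "card (multichains S (Suc n)) = (\<Sum>G\<in>S. card (multichains (Pow G) n))"
proof -
  have "multichains S (Suc n) = (\<Union>G\<in>S. add_mset G ` multichains (Pow G) n)"
  proof (intro equalityI subsetI)
    fix M assume M: "M \<in> multichains S (Suc n)"
    then have "M \<noteq> {#}" by (auto simp: multichains_def)
    then obtain G where G: "G \<in># M" "\<forall>F\<in>#M. F \<subseteq> G"
      using M multichain_has_top[of M S] by (auto simp: multichains_def)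
    from G(1) obtain N where N: "M = add_mset G N"
      by (rule mset_add)
    have "G \<in> S" "set_mset N \<in> chains S"
      using M by (simp_all add: multichains_def N chains_insert_iff)
    moreover have "set_mset N \<subseteq> Pow G"
      using G(2) N by auto
    ultimately have "G \<in> S" "N \<in> multichains (Pow G) n"
      using M chains_subset[of "set_mset N" S "set_mset N" "Pow G"]
      by (simp_all add: multichains_def N)
    then show "M \<in> (\<Union>G\<in>S. add_mset G ` multichains (Pow G) n)"
      unfolding N by blast
  next
    fix M assume "M \<in> (\<Union>G\<in>S. add_mset G ` multichains (Pow G) n)"
    then obtain G N where G: "G \<in> S" and N: "N \<in> multichains (Pow G) n" "M = add_mset G N"
      by blast
    have sub: "set_mset N \<subseteq> Pow G"
      using N(1) by (simp add: multichains_def chains_iff)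
    then have "set_mset N \<subseteq> S"
      using S(2)[OF G] by blast
    then have "set_mset N \<in> chains S"
      using N(1) chains_subset[of "set_mset N" "Pow G" "set_mset N" S] by (simp add: multichains_def)
    then show "M \<in> multichains S (Suc n)"
      using G N sub by (auto simp: multichains_def chains_insert_iff)
  qed
  also have "card \<dots> = (\<Sum>G\<in>S. card (add_mset G ` multichains (Pow G) n))"
  proof (rule card_UN_disjoint)
    show "finite S" by fact
    show "\<forall>G\<in>S. finite (add_mset G ` multichains (Pow G) n)"
      using fin by (auto intro!: finite_multichains)
    show "\<forall>G\<in>S. \<forall>G'\<in>S. G \<noteq> G' \<longrightarrow>
        add_mset G ` multichains (Pow G) n \<inter> add_mset G' ` multichains (Pow G') n = {}"
    proof (intro ballI impI equals0I, elim IntE imageE)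
      fix G G' M N N'
      assume *: "G \<noteq> G'" "M = add_mset G N" "N \<in> multichains (Pow G) n"
        "M = add_mset G' N'" "N' \<in> multichains (Pow G') n"
      \<comment> \<open>Each of the two tops is a member of the same multichain and so lies below
        the other; antisymmetry makes them equal.\<close>
      have "G \<in># add_mset G' N'" "G' \<in># add_mset G N"
        using * by (metis union_single_eq_member add_mset_add_single)+
      then show False
        using * by (auto simp: multichains_def chains_iff)
    qed
  qed
  also have "\<dots> = (\<Sum>G\<in>S. card (multichains (Pow G) n))"
    by (intro sum.cong refl card_image inj_on_add_mset)
  finally show ?thesis .
qed

text \<open>Below a top \<open>G\<close> the family becomes \<open>Pow G\<close>, so
  \<open>S\<close> varies in the induction, and the binomial theorem sums \<open>n ^ card F\<close>
  over \<open>F \<subseteq> G\<close> to \<open>(n + 1) ^ card G\<close>. For \<open>n = 0\<close>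
  only the empty face contributes.\<close>

lemma card_multichains:
  assumes "finite S" "{} \<in> S" "\<And>F G. F \<in> S \<Longrightarrow> G \<subseteq> F \<Longrightarrow> G \<in> S" "\<And>F. F \<in> S \<Longrightarrow> finite F"
  shows "card (multichains S n) = (\<Sum>F\<in>S. n ^ card F)"
  using assms
proof (induction n arbitrary: S)
  case 0
  have "multichains S 0 = {{#}}"
    by (auto simp: multichains_def chains_iff)
  moreover have "(\<Sum>F\<in>S. (0::nat) ^ card F) = (\<Sum>F\<in>S. if F = {} then 1 else 0)"
    using 0 by (intro sum.cong) (auto simp: power_0_left)
  ultimately show ?case
    using 0 by simp
next
  case (Suc n)
  have "card (multichains S (Suc n)) = (\<Sum>G\<in>S. card (multichains (Pow G) n))"
    using Suc.prems by (intro card_multichains_Suc)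
  also have "\<dots> = (\<Sum>G\<in>S. \<Sum>F\<in>Pow G. n ^ card F)"
    using Suc.prems by (intro sum.cong Suc.IH) (auto intro: finite_subset)
  also have "\<dots> = (\<Sum>G\<in>S. Suc n ^ card G)"
  proof (rule sum.cong)
    fix G assume "G \<in> S"
    then have "finite G" by (rule Suc.prems)
    then show "(\<Sum>F\<in>Pow G. n ^ card F) = Suc n ^ card G"
      using sum_power_card_Pow[of G n 1] by simp
  qed simp
  finally show ?case .
qed

text \<open>A multichain that may contain the empty face either does not contain it, or arises by
  adding one copy of it.\<close>

lemma card_multichains_eq_sd:
  assumes "simplicial_complex \<Delta>"
  shows "card (multichains \<Delta> (Suc n)) = card (monomials (sd \<Delta>) (Suc n)) + card (multichains \<Delta> n)"
proof -
  have fin: "finite (multichains \<Delta> k)" for k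
    using assms by (intro finite_multichains) (simp add: simplicial_complex_def)
  have E: "{} \<in> \<Delta>" using assms by (simp add: simplicial_complex_def)
  have sub: "monomials (sd \<Delta>) (Suc n) \<subseteq> multichains \<Delta> (Suc n)"
    using chains_subset[of _ "\<Delta> - {{}}" _ \<Delta>]
    by (auto simp: multichains_def monomials_def sd_def chains_iff[of _ "\<Delta> - {{}}"])
  have add: "add_mset {} N \<in> multichains \<Delta> (Suc n) \<longleftrightarrow> N \<in> multichains \<Delta> n" for N
    using E by (auto simp: multichains_def chains_insert_iff)
  have "multichains \<Delta> (Suc n) = monomials (sd \<Delta>) (Suc n) \<union> add_mset {} ` multichains \<Delta> n"
  proof (intro equalityI subsetI)
    fix M assume M: "M \<in> multichains \<Delta> (Suc n)"
    show "M \<in> monomials (sd \<Delta>) (Suc n) \<union> add_mset {} ` multichains \<Delta> n"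
    proof (cases "{} \<in># M")
      case True
      then obtain N where N: "M = add_mset {} N"
        by (rule mset_add)
      then have "N \<in> multichains \<Delta> n"
        using M add by simp
      then show ?thesis unfolding N by blast
    next
      case False
      have "set_mset M \<subseteq> \<Delta>"
        using M by (simp add: multichains_def chains_iff)
      with False have "set_mset M \<subseteq> \<Delta> - {{}}"
        by blast
      then have "set_mset M \<in> chains (\<Delta> - {{}})"
        using M chains_subset[of "set_mset M" \<Delta> "set_mset M"] by (simp add: multichains_def)
      then show ?thesis
        using M by (simp add: multichains_def monomials_def sd_def)
    qed
  next
    fix M assume "M \<in> monomials (sd \<Delta>) (Suc n) \<union> add_mset {} ` multichains \<Delta> n"
    then show "M \<in> multichains \<Delta> (Suc n)"
      using sub add by blast
  qed
  moreover have "monomials (sd \<Delta>) (Suc n) \<inter> add_mset {} ` multichains \<Delta> n = {}"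
    by (auto simp: monomials_def sd_def chains_iff)
  moreover have "card (add_mset {} ` multichains \<Delta> n) = card (multichains \<Delta> n)"
    by (rule card_image) (rule inj_on_add_mset)
  ultimately show ?thesis
    using fin finite_subset[OF sub fin] by (simp add: card_Un_disjoint)
qed

lemma simplicial_complex_sd:
  assumes "simplicial_complex \<Delta>"
  shows "simplicial_complex (sd \<Delta>)"
proof -
  have "finite \<Delta>" using assms by (simp add: simplicial_complex_def)
  moreover have sub: "sd \<Delta> \<subseteq> Pow \<Delta>" by (auto simp: sd_def chains_iff)
  ultimately have "finite (sd \<Delta>)" "\<forall>C\<in>sd \<Delta>. finite C"
    by (auto intro: finite_subset)
  moreover have "{} \<in> sd \<Delta>" by (simp add: sd_def chains_iff)
  moreover have "\<forall>C\<in>sd \<Delta>. \<forall>D. D \<subseteq> C \<longrightarrow> D \<in> sd \<Delta>"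
  proof (intro ballI allI impI)
    fix C D assume C: "C \<in> sd \<Delta>" and D: "D \<subseteq> C"
    have "C \<subseteq> \<Delta> - {{}}"
      using C by (simp add: sd_def chains_iff)
    with D show "D \<in> sd \<Delta>"
      using C chains_subset[OF _ D] by (simp add: sd_def)
  qed
  ultimately show ?thesis
    unfolding simplicial_complex_def by blast
qed

section \<open>Flags and the rank of the barycentric subdivision\<close>

text \<open>Adding the vertices one at a time, each enlarged set becomes the new top of the
  chain.\<close>

lemma ex_flag:
  assumes "finite F"
  shows "\<exists>C\<in>chains (Pow F - {{}}). card C = card F"
  using assms
proof (induction F rule: finite_induct)
  case (insert v F)
  then obtain C where C: "C \<in> chains (Pow F - {{}})" "card C = card F"
    by (elim bexE)
  then have sub: "C \<subseteq> Pow F - {{}}"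
    by (simp add: chains_iff)
  then have "C \<subseteq> Pow F" "C \<subseteq> Pow (insert v F) - {{}}" "\<forall>G\<in>C. G \<subseteq> insert v F"
    by blast+
  moreover from this have "finite C" "insert v F \<notin> C"
    using insert.hyps by (auto intro: finite_subset)
  ultimately have "insert (insert v F) C \<in> chains (Pow (insert v F) - {{}})"
    "card (insert (insert v F) C) = card (insert v F)"
    using C insert.hyps chains_subset[OF C(1) order_refl]
    by (simp_all add: chains_insert_iff)
  then show ?case by blast
qed (auto simp: chains_iff)

text \<open>Members of a chain have distinct cardinalities between 1 and the rank.\<close>

lemma card_chain_le:
  assumes "simplicial_complex \<Delta>" "C \<in> sd \<Delta>"
  shows "card C \<le> rank \<Delta>"
proof -
  have C: "C \<subseteq> \<Delta>" "{} \<notin> C" "\<And>F G. F \<in> C \<Longrightarrow> G \<in> C \<Longrightarrow> F \<subseteq> G \<or> G \<subseteq> F"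
    and fin: "\<And>F. F \<in> C \<Longrightarrow> finite F"
    using assms by (auto simp: sd_def chains_iff simplicial_complex_def)
  have "inj_on card C"
    using C(3) fin by (metis inj_onI card_subset_eq)
  moreover have "card ` C \<subseteq> {1..rank \<Delta>}"
    using C(1,2) fin card_le_rank[OF assms(1)] by (auto simp: Suc_le_eq card_gt_0_iff)
  ultimately show ?thesis
    using card_inj_on_le[of card C "{1..rank \<Delta>}"] by simp
qed

lemma rank_eqI:
  assumes "simplicial_complex \<Gamma>" "\<And>F. F \<in> \<Gamma> \<Longrightarrow> card F \<le> n" "\<exists>F\<in>\<Gamma>. card F = n"
  shows "rank \<Gamma> = n"
  unfolding rank_eq_Max using assms by (intro Max_eqI) (auto simp: simplicial_complex_def)

lemma rank_sd:
  assumes "simplicial_complex \<Delta>"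
  shows "rank (sd \<Delta>) = rank \<Delta>"
proof (rule rank_eqI)
  show "simplicial_complex (sd \<Delta>)" using assms by (rule simplicial_complex_sd)
  show "card C \<le> rank \<Delta>" if "C \<in> sd \<Delta>" for C
    using assms that by (rule card_chain_le)
  obtain F where F: "F \<in> \<Delta>" "card F = rank \<Delta>"
    using ex_card_rank[OF assms] by blast
  then have "finite F" using assms by (auto simp: simplicial_complex_def)
  then obtain C where C: "C \<in> chains (Pow F - {{}})" "card C = rank \<Delta>"
    using ex_flag F by metis
  have "Pow F \<subseteq> \<Delta>"
    using assms F by (auto simp: simplicial_complex_def)
  then have "C \<in> sd \<Delta>"
    using C by (auto simp: sd_def chains_iff)
  then show "\<exists>C\<in>sd \<Delta>. card C = rank \<Delta>"
    using C by blast
qed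

section \<open>Edgewise subdivision\<close>

text \<open>Hermite's identity: passing from \<open>w\<close> to \<open>w + 1\<close> drops the
  summand \<open>w div n\<close> and gains \<open>(w + n) div n\<close>, which is larger by
  1.\<close>

lemma sum_div_shift:
  assumes "0 < n"
  shows "(\<Sum>k<n. (w + k) div n) = (w::nat)"
proof (induction w)
  case 0
  then show ?case by simp
next
  case (Suc w)
  let ?f = "\<lambda>k. (w + k) div n"
  have "(\<Sum>k<n. ?f (Suc k)) + ?f 0 = (\<Sum>k<Suc n. ?f k)"
    by (subst sum.lessThan_Suc_shift) (simp add: add.commute)
  also have "\<dots> = (\<Sum>k<n. ?f k) + (?f 0 + 1)"
    using assms by simp
  finally show ?case
    using Suc by simp
qed

text \<open>Compared with \<open>a k\<close>, only earlier terms can be smaller and only later ones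
  larger, by at most 1 each. Summation gives \<open>n * a k \<le> s + k < n * (a k + 1)\<close> for
  the total \<open>s\<close>.\<close>

lemma balanced_eq_div:
  fixes a :: "nat \<Rightarrow> nat"
  assumes mono: "\<And>k l. k \<le> l \<Longrightarrow> l < n \<Longrightarrow> a k \<le> a l"
    and diff: "\<And>k l. k \<le> l \<Longrightarrow> l < n \<Longrightarrow> a l \<le> a k + 1"
    and k: "k < n"
  shows "a k = ((\<Sum>l<n. a l) + k) div n"
proof -
  have "n * a k = (\<Sum>l<n. a k)" by simp
  also have "\<dots> \<le> (\<Sum>l<n. a l + of_bool (l < k))"
  proof (rule sum_mono)
    fix l assume "l \<in> {..<n}"
    then show "a k \<le> a l + of_bool (l < k)"
      using mono[of k l] diff[of l k] k by (cases "l < k") auto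
  qed
  also have "\<dots> = (\<Sum>l<n. a l) + (\<Sum>l<n. of_bool (l < k))"
    by (rule sum.distrib)
  also have "(\<Sum>l<n. of_bool (l < k) :: nat) = (\<Sum>l<k. 1)"
    using k by (intro sum.mono_neutral_cong_right) auto
  finally have lower: "n * a k \<le> (\<Sum>l<n. a l) + k" by simp
  have "(\<Sum>l<n. a l) \<le> (\<Sum>l<n. a k + of_bool (k < l))"
  proof (rule sum_mono)
    fix l assume "l \<in> {..<n}"
    then show "a l \<le> a k + of_bool (k < l)"
      using mono[of l k] diff[of k l] k by (cases "k < l") auto
  qed
  also have "\<dots> = n * a k + (\<Sum>l<n. of_bool (k < l))"
    by (simp add: sum.distrib)
  also have "(\<Sum>l<n. of_bool (k < l) :: nat) = (\<Sum>l\<in>{Suc k..<n}. 1)"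
    by (intro sum.mono_neutral_cong_right) auto
  finally have "(\<Sum>l<n. a l) + k < n * Suc (a k)"
    using k by simp
  then show ?thesis
    using lower div_nat_eqI[of n "a k"] by simp
qed

section \<open>Partial sums and the decomposition of monomials into balanced pieces\<close>

text \<open>The bound is exclusive, unlike in \<open>esd_iota\<close>: the value at 0 is 0 and
  consecutive differences return \<open>u\<close>.\<close>

definition partial_sum :: "'a list \<Rightarrow> ('a \<Rightarrow> nat) \<Rightarrow> nat \<Rightarrow> nat" where
  "partial_sum vs u i = (\<Sum>l<i. u (vs ! l))"

lemma partial_sum_0 [simp]: "partial_sum vs u 0 = 0"
  by (simp add: partial_sum_def)

lemma partial_sum_Suc: "partial_sum vs u (Suc i) = partial_sum vs u i + u (vs ! i)"
  by (simp add: partial_sum_def)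

lemma esd_iota_eq: "esd_iota vs u i = int (partial_sum vs u (Suc i))"
  by (simp add: esd_iota_def partial_sum_def lessThan_Suc_atMost)

lemma sum_set_eq_partial_sum: "distinct vs \<Longrightarrow> (\<Sum>v\<in>set vs. u v) = partial_sum vs u (length vs)"
  by (simp add: partial_sum_def sum_list_distinct_conv_sum_set[symmetric] sum_list_sum_nth
      atLeast0LessThan)

lemma eq_of_partial_sums:
  assumes "\<And>i. i < length vs \<Longrightarrow> partial_sum vs u (Suc i) = partial_sum vs w (Suc i)"
    and "supp u \<subseteq> set vs" "supp w \<subseteq> set vs"
  shows "u = w"
proof
  fix v
  show "u v = w v"
  proof (cases "v \<in> set vs")
    case True
    then obtain i where i: "i < length vs" "vs ! i = v"
      by (auto simp: in_set_conv_nth)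
    have "partial_sum vs u i = partial_sum vs w i"
      using assms(1) i by (cases i) auto
    then show ?thesis
      using assms(1)[OF i(1)] i by (simp add: partial_sum_Suc)
  next
    case False
    then have "v \<notin> supp u" "v \<notin> supp w"
      using assms(2,3) by blast+
    then show ?thesis
      by (simp add: supp_def)
  qed
qed

text \<open>Regarding each vertex \<open>u\<close> of the edgewise subdivision as the monomial with
  exponents \<open>u\<close>, this is the exponent vector of the product over
  \<open>M\<close>.\<close>

definition total :: "('a \<Rightarrow> nat) multiset \<Rightarrow> 'a \<Rightarrow> nat" where
  "total M v = (\<Sum>u\<in>#M. u v)"

lemma total_mset: "total (mset us) v = (\<Sum>k<length us. (us ! k) v)"
  unfolding total_def mset_map[symmetric] sum_mset_sum_list
  by (simp add: sum_list_sum_nth atLeast0LessThan)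

lemma partial_sum_total:
  "partial_sum vs (total (mset us)) i = (\<Sum>k<length us. partial_sum vs (us ! k) i)"
  unfolding partial_sum_def total_mset by (rule sum.swap)

lemma supp_total: "supp (total M) = (\<Union>u\<in>set_mset M. supp u)"
  by (auto simp: supp_def total_def)

text \<open>A vertex of the \<open>n\<close>-fold edgewise subdivision is the exponent vector of a
  monomial of degree \<open>n\<close>.\<close>

lemma bij_betw_count_monomials:
  assumes "simplicial_complex \<Gamma>" "\<Union>\<Gamma> \<subseteq> set vs"
  shows "bij_betw count (monomials \<Gamma> n) (esd_vertices n vs \<Gamma>)"
proof (rule bij_betwI')
  fix M assume M: "M \<in> monomials \<Gamma> n"
  have "size M = (\<Sum>v\<in>set vs. count M v)"
    unfolding size_multiset_overloaded_eq using M assms(2)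
    by (intro sum.mono_neutral_left) (auto simp: monomials_def count_eq_zero_iff)
  moreover have "supp (count M) = set_mset M"
    by (auto simp: supp_def count_eq_zero_iff)
  ultimately show "count M \<in> esd_vertices n vs \<Gamma>"
    using M by (simp add: esd_vertices_def monomials_def)
next
  fix u assume u: "u \<in> esd_vertices n vs \<Gamma>"
  then have "finite (supp u)"
    using assms by (auto simp: esd_vertices_def simplicial_complex_def)
  then have count: "count (Abs_multiset u) = u"
    by (simp add: supp_def)
  have supp: "set_mset (Abs_multiset u) = supp u"
    using count_eq_zero_iff[of "Abs_multiset u"] by (auto simp: count supp_def)
  have "supp u \<in> \<Gamma>" "(\<Sum>v\<in>set vs. u v) = n"
    using u by (auto simp: esd_vertices_def)
  moreover have "size (Abs_multiset u) = (\<Sum>v\<in>set vs. u v)"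
    unfolding size_multiset_overloaded_eq count supp using assms(2) calculation(1)
    by (intro sum.mono_neutral_left) (auto simp: supp_def)
  ultimately have "Abs_multiset u \<in> monomials \<Gamma> n"
    by (simp add: monomials_def supp)
  then show "\<exists>M\<in>monomials \<Gamma> n. u = count M"
    using count by metis
qed (simp add: multiset_eq_iff fun_eq_iff)

text \<open>Any two members of a face are comparable in all partial sums, with gaps at most 1.
  Sorting by the sum \<open>key\<close> of all partial sums respects this order: if a later entry
  were dominated by an earlier one, the keys would agree and hence all partial sums.\<close>

lemma sorted_face_list:
  assumes "set_mset M \<in> esd r vs \<Gamma>"
  obtains us where "mset us = M"
    "\<And>k l i. k \<le> l \<Longrightarrow> l < length us \<Longrightarrow> i < length vs \<Longrightarrow>
      partial_sum vs (us ! k) (Suc i) \<le> partial_sum vs (us ! l) (Suc i)"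
    "\<And>k l i. k \<le> l \<Longrightarrow> l < length us \<Longrightarrow> i < length vs \<Longrightarrow>
      partial_sum vs (us ! l) (Suc i) \<le> partial_sum vs (us ! k) (Suc i) + 1"
proof -
  define key where "key u = (\<Sum>i<length vs. partial_sum vs u (Suc i))" for u
  obtain xs where xs: "mset xs = M"
    using ex_mset by blast
  define us where "us = sort_key key xs"
  have us: "mset us = M"
    by (simp add: us_def xs)
  have main: "partial_sum vs (us ! k) (Suc i) \<le> partial_sum vs (us ! l) (Suc i) \<and>
      partial_sum vs (us ! l) (Suc i) \<le> partial_sum vs (us ! k) (Suc i) + 1"
    if kl: "k \<le> l" "l < length us" and i: "i < length vs" for k l i
  proof -
    let ?u = "us ! k" and ?w = "us ! l"
    have in_M: "?u \<in># M" "?w \<in># M"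
      using kl by (auto simp: us[symmetric])
    have "sorted (map key us)"
      by (simp add: us_def)
    then have key: "key ?u \<le> key ?w"
      using kl sorted_nth_mono[of "map key us" k l] by simp
    from assms in_M consider
      "\<forall>i<length vs. esd_iota vs ?w i - esd_iota vs ?u i \<in> {0, 1}" |
      "\<forall>i<length vs. esd_iota vs ?u i - esd_iota vs ?w i \<in> {0, 1}"
      unfolding esd_def by blast
    then show ?thesis
    proof cases
      case 1
      then show ?thesis
        using i by (auto simp: esd_iota_eq)
    next
      case 2
      then have le: "partial_sum vs ?w (Suc j) \<le> partial_sum vs ?u (Suc j)" if "j < length vs" for j
        using that by (force simp: esd_iota_eq)
      then have "key ?w \<le> key ?u"
        unfolding key_def by (intro sum_mono) simp
      with key have "key ?w = key ?u" by simp
      then have "partial_sum vs ?w (Suc i) = partial_sum vs ?u (Suc i)"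
        unfolding key_def by (rule sum_mono_inv) (simp_all add: le i)
      then show ?thesis by simp
    qed
  qed
  then show ?thesis
    using that us by blast
qed

lemma ex_function_on_list:
  assumes "distinct vs"
  shows "\<exists>u :: 'a \<Rightarrow> nat. (\<forall>i<length vs. u (vs ! i) = a i) \<and> supp u \<subseteq> set vs"
proof -
  let ?m = "map_of (zip vs (map a [0..<length vs]))"
  let ?u = "\<lambda>v. case ?m v of None \<Rightarrow> 0 | Some x \<Rightarrow> x"
  have "?u (vs ! i) = a i" if "i < length vs" for i
    using that map_of_zip_nth[of vs "map a [0..<length vs]" i] assms by simp
  moreover have "supp ?u \<subseteq> set vs"
  proof
    fix v assume v: "v \<in> supp ?u"
    show "v \<in> set vs"
    proof (rule ccontr)
      assume "v \<notin> set vs"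
      then have "?m v = None"
        by (subst map_of_zip_is_None) auto
      with v show False by (simp add: supp_def)
    qed
  qed
  ultimately show ?thesis
    by (intro exI[of _ ?u]) simp
qed

lemma sum_diff_mono_nat:
  fixes g :: "nat \<Rightarrow> nat"
  assumes "mono g"
  shows "(\<Sum>l<i. g (Suc l) - g l) = g i - g 0"
  using assms by (induction i) (auto simp: mono_def)

text \<open>The \<open>n\<close> balanced pieces of a function \<open>w\<close> of weight \<open>r n\<close>: the partial sums of the
  \<open>k\<close>-th piece are those of \<open>w\<close>, divided by \<open>n\<close> after adding \<open>k\<close>.\<close>

lemma bij_betw_total:
  assumes \<Gamma>: "simplicial_complex \<Gamma>" and vs: "distinct vs" "\<Union>\<Gamma> \<subseteq> set vs" and n: "0 < n"
  shows "bij_betw total (monomials (esd r vs \<Gamma>) n) (esd_vertices (r * n) vs \<Gamma>)"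
proof (rule bij_betwI')
  \<comment> \<open>By \<open>balanced_eq_div\<close> the sorted list, and so the multiset, can be
    recovered from its total; this gives injectivity.\<close>
  have face_list: "\<exists>us. mset us = M \<and> length us = n \<and> (\<forall>u\<in>set us. supp u \<subseteq> set vs) \<and>
     (\<forall>k<n. \<forall>i<length vs. partial_sum vs (us ! k) (Suc i) = (partial_sum vs (total M) (Suc i) + k) div n)"
    if M: "M \<in> monomials (esd r vs \<Gamma>) n" for M
  proof -
    have "set_mset M \<in> esd r vs \<Gamma>" and size: "size M = n"
      using M by (auto simp: monomials_def)
    from sorted_face_list[OF this(1)] obtain us where us: "mset us = M"
      "\<And>k l i. k \<le> l \<Longrightarrow> l < length us \<Longrightarrow> i < length vs \<Longrightarrow>
        partial_sum vs (us ! k) (Suc i) \<le> partial_sum vs (us ! l) (Suc i)"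
      "\<And>k l i. k \<le> l \<Longrightarrow> l < length us \<Longrightarrow> i < length vs \<Longrightarrow>
        partial_sum vs (us ! l) (Suc i) \<le> partial_sum vs (us ! k) (Suc i) + 1"
      by blast
    have len: "length us = n"
      using us(1) size by auto
    have "supp u \<subseteq> set vs" if "u \<in> set us" for u
    proof -
      have "u \<in># M" using that us(1) by auto
      then have "supp u \<in> \<Gamma>"
        using \<open>set_mset M \<in> esd r vs \<Gamma>\<close> by (auto simp: esd_def esd_vertices_def)
      then show ?thesis using vs(2) by blast
    qed
    moreover have "partial_sum vs (us ! k) (Suc i) = (partial_sum vs (total M) (Suc i) + k) div n"
      if "k < n" "i < length vs" for k i
      unfolding us(1)[symmetric] partial_sum_total len
      by (rule balanced_eq_div) (use us(2,3) that len in auto)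
    ultimately show ?thesis
      using us(1) len by blast
  qed
  show "(total M = total N) \<longleftrightarrow> (M = N)"
    if M: "M \<in> monomials (esd r vs \<Gamma>) n" and N: "N \<in> monomials (esd r vs \<Gamma>) n" for M N
  proof
    assume eq: "total M = total N"
    obtain us ws where us: "mset us = M" "length us = n" "\<forall>u\<in>set us. supp u \<subseteq> set vs"
      "\<forall>k<n. \<forall>i<length vs. partial_sum vs (us ! k) (Suc i) = (partial_sum vs (total M) (Suc i) + k) div n"
      and ws: "mset ws = N" "length ws = n" "\<forall>u\<in>set ws. supp u \<subseteq> set vs"
      "\<forall>k<n. \<forall>i<length vs. partial_sum vs (ws ! k) (Suc i) = (partial_sum vs (total N) (Suc i) + k) div n"
      using face_list[OF M] face_list[OF N] by (elim exE conjE)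
    have "us = ws"
    proof (rule nth_equalityI)
      fix k assume "k < length us"
      then show "us ! k = ws ! k"
        using us(2-4) ws(2-4) eq by (intro eq_of_partial_sums[of vs]) simp_all
    qed (simp add: us ws)
    then show "M = N" using us(1) ws(1) by simp
  qed simp
  show "total M \<in> esd_vertices (r * n) vs \<Gamma>" if M: "M \<in> monomials (esd r vs \<Gamma>) n" for M
  proof -
    obtain us where us: "mset us = M"
      using ex_mset by blast
    have len: "length us = n"
      using M us by (auto simp: monomials_def)
    have "us ! k \<in># M" if "k < n" for k
      using that us len by (metis nth_mem set_mset_mset)
    then have *: "(\<Sum>v\<in>set vs. (us ! k) v) = r" if "k < n" for k
      using that M by (auto simp: monomials_def esd_def esd_vertices_def)
    have "(\<Sum>v\<in>set vs. total M v) = (\<Sum>v\<in>set vs. \<Sum>k<n. (us ! k) v)"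
      by (simp only: us[symmetric] total_mset len)
    also have "\<dots> = (\<Sum>k<n. \<Sum>v\<in>set vs. (us ! k) v)"
      by (rule sum.swap)
    also have "\<dots> = r * n"
      by (simp add: *)
    finally have "(\<Sum>v\<in>set vs. total M v) = r * n" .
    moreover have "supp (total M) \<in> \<Gamma>"
      using M by (simp add: supp_total monomials_def esd_def)
    ultimately show ?thesis
      by (simp add: esd_vertices_def)
  qed
  show "\<exists>M\<in>monomials (esd r vs \<Gamma>) n. w = total M" if w: "w \<in> esd_vertices (r * n) vs \<Gamma>" for w
  proof -
    define W where "W = partial_sum vs w"
    have supp_w: "supp w \<in> \<Gamma>" and W_last: "W (length vs) = r * n"
      using w sum_set_eq_partial_sum[OF vs(1)] by (auto simp: esd_vertices_def W_def)
    then have supp_w': "supp w \<subseteq> set vs"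
      using vs(2) by blast
    have mono_W: "mono (\<lambda>i. (W i + k) div n)" for k
      by (rule mono_iff_le_Suc[THEN iffD2]) (simp add: W_def partial_sum_Suc div_le_mono)
    \<comment> \<open>The values of the \<open>k\<close>-th piece are differences of its prescribed
      partial sums; \<open>mono_W\<close> makes the truncated subtraction exact.\<close>
    have "\<forall>k. \<exists>u. (\<forall>i<length vs. u (vs ! i) = (W (Suc i) + k) div n - (W i + k) div n) \<and> supp u \<subseteq> set vs"
      by (intro allI ex_function_on_list[OF vs(1)])
    then obtain p where p: "\<And>k i. i < length vs \<Longrightarrow> p k (vs ! i) = (W (Suc i) + k) div n - (W i + k) div n"
      and supp_p: "\<And>k. supp (p k) \<subseteq> set vs"
      by metis
    have psum: "partial_sum vs (p k) i = (W i + k) div n" if "i \<le> length vs" "k < n" for i k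
    proof -
      have "partial_sum vs (p k) i = (\<Sum>l<i. (W (Suc l) + k) div n - (W l + k) div n)"
        unfolding partial_sum_def using that(1) by (intro sum.cong) (simp_all add: p)
      also have "\<dots> = (W i + k) div n - (W 0 + k) div n"
        by (rule sum_diff_mono_nat[OF mono_W])
      finally show ?thesis using that by (simp add: W_def)
    qed
    define us where "us = map p [0..<n]"
    have nth: "us ! k = p k" if "k < n" for k
      using that by (simp add: us_def)
    have len: "length us = n" by (simp add: us_def)
    have total: "total (mset us) = w"
    proof (rule eq_of_partial_sums[of vs])
      fix i assume "i < length vs"
      then have "partial_sum vs (total (mset us)) (Suc i) = (\<Sum>k<n. (W (Suc i) + k) div n)"
        unfolding partial_sum_total len by (intro sum.cong) (simp_all add: nth psum)
      also have "\<dots> = W (Suc i)"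
        by (rule sum_div_shift[OF n])
      finally show "partial_sum vs (total (mset us)) (Suc i) = partial_sum vs w (Suc i)"
        by (simp add: W_def)
    next
      show "supp (total (mset us)) \<subseteq> set vs"
        using supp_p by (auto simp: supp_total us_def)
    qed (rule supp_w')
    have sub: "supp (p k) \<subseteq> supp w" if "k < n" for k
      using that by (auto simp: total[symmetric] supp_total us_def)
    have "p k \<in> esd_vertices r vs \<Gamma>" if k: "k < n" for k
    proof -
      have "supp (p k) \<in> \<Gamma>"
        using \<Gamma> supp_w sub[OF k] by (auto simp: simplicial_complex_def)
      \<comment> \<open>The last partial sum is \<open>(r * n + k) div n\<close>, which is
        \<open>r\<close> because \<open>k < n\<close>.\<close>
      moreover have "(\<Sum>v\<in>set vs. p k v) = r"
        using k by (simp add: sum_set_eq_partial_sum[OF vs(1)] psum W_last)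
      ultimately show ?thesis by (simp add: esd_vertices_def)
    qed
    moreover have "(\<Union>u\<in>set_mset (mset us). supp u) \<in> \<Gamma>"
      using supp_w by (simp only: supp_total[symmetric] total)
    moreover have "\<forall>i<length vs. esd_iota vs (p l) i - esd_iota vs (p k) i \<in> {0, 1}"
      if "k \<le> l" "l < n" for k l
    proof (intro allI impI)
      fix i assume i: "i < length vs"
      have "(W (Suc i) + k) div n \<le> (W (Suc i) + l) div n"
        using that by (simp add: div_le_mono)
      moreover have "(W (Suc i) + l) div n \<le> (W (Suc i) + k + n) div n"
        using that by (intro div_le_mono) simp
      moreover have "(W (Suc i) + k + n) div n = (W (Suc i) + k) div n + 1"
        using n by simp
      ultimately show "esd_iota vs (p l) i - esd_iota vs (p k) i \<in> {0, 1}"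
        using i that psum by (auto simp: esd_iota_eq)
    qed
    then have "(\<forall>i<length vs. esd_iota vs (p k) i - esd_iota vs (p l) i \<in> {0, 1}) \<or>
        (\<forall>i<length vs. esd_iota vs (p l) i - esd_iota vs (p k) i \<in> {0, 1})"
      if "k < n" "l < n" for k l
      using that by (cases "k \<le> l") auto
    ultimately have "set_mset (mset us) \<in> esd r vs \<Gamma>"
      unfolding esd_def by (auto simp: us_def)
    then show ?thesis
      using total len by (intro bexI[of _ "mset us"]) (simp_all add: monomials_def)
  qed
qed

lemma simplicial_complex_esd:
  assumes \<Gamma>: "simplicial_complex \<Gamma>" and "\<Union>\<Gamma> \<subseteq> set vs"
  shows "simplicial_complex (esd r vs \<Gamma>)"
proof -
  have "finite (esd_vertices r vs \<Gamma>)"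
    using bij_betw_finite[OF bij_betw_count_monomials[OF assms, of r]] finite_monomials[OF \<Gamma>]
    by simp
  moreover have "esd r vs \<Gamma> \<subseteq> Pow (esd_vertices r vs \<Gamma>)"
    by (auto simp: esd_def)
  ultimately have "finite (esd r vs \<Gamma>)" "\<forall>E\<in>esd r vs \<Gamma>. finite E"
    by (auto intro: finite_subset)
  moreover have "{} \<in> esd r vs \<Gamma>"
    using \<Gamma> by (simp add: esd_def simplicial_complex_def)
  moreover have "\<forall>E\<in>esd r vs \<Gamma>. \<forall>D. D \<subseteq> E \<longrightarrow> D \<in> esd r vs \<Gamma>"
  proof (intro ballI allI impI)
    fix E D assume E: "E \<in> esd r vs \<Gamma>" and D: "D \<subseteq> E"
    have "(\<Union>u\<in>D. supp u) \<subseteq> (\<Union>u\<in>E. supp u)" using D by blast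
    moreover have "(\<Union>u\<in>E. supp u) \<in> \<Gamma>" using E by (simp add: esd_def)
    ultimately have "(\<Union>u\<in>D. supp u) \<in> \<Gamma>"
      using \<Gamma> by (simp add: simplicial_complex_def)
    then show "D \<in> esd r vs \<Gamma>"
      using E D unfolding esd_def by blast
  qed
  ultimately show ?thesis
    unfolding simplicial_complex_def by blast
qed

lemma monomials_0: "{} \<in> \<Gamma> \<Longrightarrow> monomials \<Gamma> 0 = {{#}}"
  by (auto simp: monomials_def)

text \<open>Both sides count exponent vectors of weight \<open>r * n\<close>. Degree 0 is separate
  because the pieces are formed by division by \<open>n\<close>.\<close>

lemma card_monomials_esd:
  assumes \<Gamma>: "simplicial_complex \<Gamma>" and vs: "distinct vs" "\<Union>\<Gamma> \<subseteq> set vs"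
  shows "card (monomials (esd r vs \<Gamma>) n) = card (monomials \<Gamma> (r * n))"
proof (cases "n = 0")
  case True
  have "{} \<in> \<Gamma>" "{} \<in> esd r vs \<Gamma>"
    using \<Gamma> simplicial_complex_esd[OF \<Gamma> vs(2), of r] by (simp_all add: simplicial_complex_def)
  then show ?thesis
    using True by (simp add: monomials_0)
next
  case False
  then show ?thesis
    using bij_betw_same_card[OF bij_betw_total[OF assms, of n r]]
      bij_betw_same_card[OF bij_betw_count_monomials[OF \<Gamma> vs(2), of "r * n"]] by simp
qed

section \<open>The transformation matrix\<close>

text \<open>The monomials supported on a single face of maximal size already suffice.\<close>

lemma card_monomials_ge:
  assumes "simplicial_complex \<Gamma>" "1 \<le> rank \<Gamma>"
  shows "n choose (rank \<Gamma> - 1) \<le> card (monomials \<Gamma> (Suc n))"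
proof -
  obtain F where F: "F \<in> \<Gamma>" "card F = rank \<Gamma>"
    using ex_card_rank[OF assms(1)] by blast
  then have "finite F" "F \<noteq> {}"
    using assms by (auto simp: simplicial_complex_def)
  then have "card {M. size M = Suc n \<and> set_mset M = F} = n choose (rank \<Gamma> - 1)"
    using F card_mset_with_support by metis
  moreover have "finite \<Gamma>"
    using assms(1) by (simp add: simplicial_complex_def)
  ultimately show ?thesis
    unfolding card_monomials_sum[OF assms(1)]
    using member_le_sum[OF F(1), of "\<lambda>F. card {M. size M = Suc n \<and> set_mset M = F}"] by simp
qed

lemma card_monomials_le:
  assumes "simplicial_complex \<Gamma>"
  shows "card (monomials \<Gamma> (Suc n)) \<le> card \<Gamma> * Suc n ^ (rank \<Gamma> - 1)"
proof -
  have "card {M. size M = Suc n \<and> set_mset M = F} \<le> Suc n ^ (rank \<Gamma> - 1)" if F: "F \<in> \<Gamma>" for F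
  proof (cases "F = {}")
    case True
    then have "{M. size M = Suc n \<and> set_mset M = F} = {}" by auto
    then show ?thesis by (simp only: card.empty)
  next
    case False
    have "finite F" using F assms by (auto simp: simplicial_complex_def)
    then have "card {M. size M = Suc n \<and> set_mset M = F} = n choose (card F - 1)"
      using False by (rule card_mset_with_support)
    also have "\<dots> \<le> n ^ (card F - 1)"
      by (cases "card F - 1 \<le> n") (auto simp: binomial_le_pow binomial_eq_0)
    also have "\<dots> \<le> Suc n ^ (card F - 1)"
      by (intro power_mono) auto
    also have "\<dots> \<le> Suc n ^ (rank \<Gamma> - 1)"
      using card_le_rank[OF assms F] by (intro power_increasing) auto
    finally show ?thesis .
  qed
  then have "(\<Sum>F\<in>\<Gamma>. card {M. size M = Suc n \<and> set_mset M = F})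
      \<le> of_nat (card \<Gamma>) * Suc n ^ (rank \<Gamma> - 1)"
    by (rule sum_bounded_above)
  then show ?thesis
    by (simp only: card_monomials_sum[OF assms] of_nat_id)
qed

text \<open>The left-hand side is the standard lower bound for \<open>n choose a\<close>. If
  \<open>b < a\<close>, division by \<open>n^b\<close> would bound a positive power of
  \<open>n\<close>.\<close>

lemma exponent_le_of_growth:
  fixes a b :: nat and c :: real
  assumes "\<And>n. a \<le> n \<Longrightarrow> (real n / real a) ^ a \<le> c * (real n + 1) ^ b" and "c \<ge> 0"
  shows "a \<le> b"
proof (rule ccontr)
  assume "\<not> a \<le> b"
  then have ab: "b < a" by simp
  \<comment> \<open>The factor \<open>a^a\<close> clears the denominator, and \<open>2^b\<close>
    comes from \<open>n + 1 \<le> 2 n\<close>.\<close>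
  define K where "K = real a ^ a * c * 2 ^ b"
  obtain m where m: "K < real m" using reals_Archimedean2 by blast
  define n where "n = max m a"
  have n: "a \<le> n" "K < real n" "1 \<le> real n"
    using m ab by (auto simp: n_def)
  have "real n ^ a = real a ^ a * (real n / real a) ^ a"
    using ab by (simp add: power_divide)
  also have "\<dots> \<le> real a ^ a * (c * (real n + 1) ^ b)"
    using assms(1)[OF n(1)] by (intro mult_left_mono) auto
  also have "\<dots> \<le> real a ^ a * (c * (2 * real n) ^ b)"
    using n assms(2) by (intro mult_left_mono power_mono) auto
  also have "\<dots> = K * real n ^ b"
    by (simp add: K_def power_mult_distrib)
  finally have "real n ^ (a - b) * real n ^ b \<le> K * real n ^ b"
    using ab by (simp add: power_add[symmetric])
  then have "real n ^ (a - b) \<le> K"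
    using n by simp
  moreover have "real n \<le> real n ^ (a - b)"
    using power_increasing[of 1 "a - b" "real n"] n ab by simp
  ultimately show False using n(2) by linarith
qed

text \<open>Dilating the degree by \<open>s\<close> changes the upper bound only by the constant
  \<open>s ^ (rank \<Gamma>' - 1)\<close>.\<close>

lemma rank_le_of_monomials_le:
  assumes \<Gamma>: "simplicial_complex \<Gamma>" "1 \<le> rank \<Gamma>" and \<Gamma>': "simplicial_complex \<Gamma>'"
    and le: "\<And>n. card (monomials \<Gamma> n) \<le> card (monomials \<Gamma>' (s * n))" and s: "1 \<le> s"
  shows "rank \<Gamma> - 1 \<le> rank \<Gamma>' - 1"
proof (rule exponent_le_of_growth)
  fix n assume n: "rank \<Gamma> - 1 \<le> n"
  let ?a = "rank \<Gamma> - 1" and ?b = "rank \<Gamma>' - 1"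
  obtain m where m: "s * Suc n = Suc m"
    using s by (cases "s * Suc n") auto
  have "(real n / real ?a) ^ ?a \<le> real (n choose ?a)"
    using n by (rule binomial_ge_n_over_k_pow_k)
  also have "\<dots> \<le> real (card (monomials \<Gamma> (Suc n)))"
    using card_monomials_ge[OF \<Gamma>, of n] by simp
  also have "\<dots> \<le> real (card (monomials \<Gamma>' (Suc m)))"
    using le[of "Suc n"] by (simp only: m of_nat_le_iff)
  also have "\<dots> \<le> real (card \<Gamma>' * (s * Suc n) ^ ?b)"
    using card_monomials_le[OF \<Gamma>', of m] by (simp only: m of_nat_le_iff)
  also have "\<dots> = (real (card \<Gamma>') * real s ^ ?b) * (real n + 1) ^ ?b"
    by (simp only: power_mult_distrib of_nat_mult of_nat_power of_nat_Suc add.commute mult.assoc)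
  finally show "(real n / real ?a) ^ ?a \<le> (real (card \<Gamma>') * real s ^ ?b) * (real n + 1) ^ ?b" .
qed simp

text \<open>Taking \<open>r\<close>-th powers of monomials is injective and keeps the
  support.\<close>

lemma card_monomials_mult_mono:
  assumes "simplicial_complex \<Gamma>" "1 \<le> r"
  shows "card (monomials \<Gamma> n) \<le> card (monomials \<Gamma> (r * n))"
proof (rule card_inj_on_le[where f = "repeat_mset r"])
  show "inj_on (repeat_mset r) (monomials \<Gamma> n)"
    using assms(2) by (auto simp: inj_on_def multiset_eq_iff)
  have "set_mset (repeat_mset r M) = set_mset M" for M :: "'a multiset"
    using assms(2) by (auto simp flip: count_greater_zero_iff)
  then show "repeat_mset r ` monomials \<Gamma> n \<subseteq> monomials \<Gamma> (r * n)"
    by (auto simp: monomials_def)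
  show "finite (monomials \<Gamma> (r * n))"
    by (rule finite_monomials[OF assms(1)])
qed

text \<open>Separates rank 0 from rank 1, which the truncated \<open>rank - 1\<close> of the growth
  estimates cannot distinguish.\<close>

lemma rank_pos_iff:
  assumes "simplicial_complex \<Gamma>"
  shows "1 \<le> rank \<Gamma> \<longleftrightarrow> monomials \<Gamma> 1 \<noteq> {}"
proof
  assume "1 \<le> rank \<Gamma>"
  then obtain F v where F: "F \<in> \<Gamma>" "v \<in> F"
    using ex_card_rank[OF assms] by (metis all_not_in_conv card.empty not_one_le_zero)
  then have "{v} \<in> \<Gamma>"
    using assms by (auto simp: simplicial_complex_def)
  then have "{#v#} \<in> monomials \<Gamma> 1"
    by (simp add: monomials_def)
  then show "monomials \<Gamma> 1 \<noteq> {}" by blast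
next
  assume "monomials \<Gamma> 1 \<noteq> {}"
  then obtain M where M: "size M = 1" "set_mset M \<in> \<Gamma>"
    by (auto simp: monomials_def)
  then obtain v where "M = {#v#}"
    by (metis size_1_singleton_mset)
  then show "1 \<le> rank \<Gamma>"
    using card_le_rank[OF assms M(2)] by simp
qed

text \<open>The count for the subdivision in degree \<open>n\<close> is that of
  \<open>\<Gamma>\<close> in degree \<open>r * n\<close>, hence at least that in degree
  \<open>n\<close>; the growth exponents therefore agree.\<close>

lemma rank_esd:
  assumes \<Gamma>: "simplicial_complex \<Gamma>" "1 \<le> rank \<Gamma>" and vs: "distinct vs" "\<Union>\<Gamma> \<subseteq> set vs"
    and r: "1 \<le> r"
  shows "rank (esd r vs \<Gamma>) = rank \<Gamma>"
proof -
  have esd: "simplicial_complex (esd r vs \<Gamma>)"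
    by (rule simplicial_complex_esd[OF \<Gamma>(1) vs(2)])
  have le: "card (monomials \<Gamma> n) \<le> card (monomials (esd r vs \<Gamma>) n)" for n
    using card_monomials_mult_mono[OF \<Gamma>(1) r] by (simp add: card_monomials_esd[OF \<Gamma>(1) vs])
  have pos: "1 \<le> rank (esd r vs \<Gamma>)"
  proof -
    have "0 < card (monomials \<Gamma> 1)"
      using rank_pos_iff[OF \<Gamma>(1)] \<Gamma>(2) finite_monomials[OF \<Gamma>(1)] by (simp add: card_gt_0_iff)
    then have "0 < card (monomials (esd r vs \<Gamma>) 1)"
      using le[of 1] by linarith
    then show ?thesis
      using rank_pos_iff[OF esd] by auto
  qed
  have "rank \<Gamma> - 1 \<le> rank (esd r vs \<Gamma>) - 1"
    by (rule rank_le_of_monomials_le[OF \<Gamma> esd, of 1]) (simp_all add: le)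
  moreover have "rank (esd r vs \<Gamma>) - 1 \<le> rank \<Gamma> - 1"
    by (rule rank_le_of_monomials_le[OF esd pos \<Gamma>(1) _ r]) (simp add: card_monomials_esd[OF \<Gamma>(1) vs])
  ultimately show ?thesis
    using pos \<Gamma>(2) by linarith
qed

section \<open>The \<open>h\<close>-polynomial of the colored subdivision\<close>

text \<open>Forbidding the empty face multiplies the multichain series by \<open>1 - x\<close>. This
  supplies the last of the \<open>d + 1\<close> factors that turn \<open>bary_series\<close> into
  \<open>bary_column\<close>.\<close>

lemma sd_series:
  assumes \<Delta>: "simplicial_complex \<Delta>" "rank \<Delta> = d"
  shows "one_minus_X ^ d * Abs_fps (\<lambda>n. real (card (monomials (sd \<Delta>) n)))
    = (\<Sum>j\<le>d. fps_const (coeff (h_poly \<Delta>) j) * bary_column d j)"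
proof -
  let ?T = "Abs_fps (\<lambda>n. real (card (multichains \<Delta> n)))"
  have "{} \<in> sd \<Delta>" "{} \<in> \<Delta>"
    using simplicial_complex_sd[OF \<Delta>(1)] \<Delta>(1) by (simp_all add: simplicial_complex_def)
  have count: "card (multichains \<Delta> n) = (\<Sum>F\<in>\<Delta>. n ^ card F)" for n
    using \<Delta>(1) by (intro card_multichains) (auto simp: simplicial_complex_def)
  have "multichains \<Delta> 0 = {{#}}"
    by (auto simp: multichains_def chains_iff)
  then have S: "Abs_fps (\<lambda>n. real (card (monomials (sd \<Delta>) n))) = one_minus_X * ?T"
    using card_multichains_eq_sd[OF \<Delta>(1)] \<open>{} \<in> sd \<Delta>\<close>
    by (intro fps_ext) (auto simp: left_diff_distrib monomials_0 gr0_conv_Suc)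
  have T: "?T = (\<Sum>j\<le>d. fps_const (coeff (h_poly \<Delta>) j) * bary_series d j)"
    by (rule fps_ext) (simp add: fps_sum_nth bary_series_def sum_h_poly_coeff[OF \<Delta>] count)
  show ?thesis
    unfolding S T sum_distrib_left
    by (intro sum.cong refl) (simp add: bary_column_eq mult_ac)
qed

lemma h_poly_colored_barycentric:
  assumes \<Delta>: "simplicial_complex \<Delta>" "rank \<Delta> = d" and "1 \<le> d" "1 \<le> r"
    and \<Delta>': "colored_barycentric r \<Delta> \<Delta>'"
  shows "rank \<Delta>' = d"
    and "coeff (h_poly \<Delta>') i = (\<Sum>j\<le>d. H_entry d r i j * coeff (h_poly \<Delta>) j)"
proof -
  obtain vs where vs: "distinct vs" "set vs = \<Union>(sd \<Delta>)" and \<Delta>'_def: "\<Delta>' = esd r vs (sd \<Delta>)"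
    using \<Delta>' by (auto simp: colored_barycentric_def)
  have sd: "simplicial_complex (sd \<Delta>)"
    by (rule simplicial_complex_sd[OF \<Delta>(1)])
  have rank_sd: "rank (sd \<Delta>) = d"
    using rank_sd[OF \<Delta>(1)] \<Delta>(2) by simp
  have sub: "\<Union>(sd \<Delta>) \<subseteq> set vs" using vs by simp
  show rank: "rank \<Delta>' = d"
    unfolding \<Delta>'_def using rank_esd[OF sd _ vs(1) sub] rank_sd assms by simp
  let ?S = "Abs_fps (\<lambda>n. real (card (monomials (sd \<Delta>) n)))"
  have "fps_of_poly (h_poly \<Delta>') = one_minus_X ^ d * Abs_fps (\<lambda>n. fps_nth ?S (r * n))"
    using h_poly_series[OF simplicial_complex_esd[OF sd sub], of r] card_monomials_esd[OF sd vs(1) sub, of r] rank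
    by (simp add: \<Delta>'_def)
  also have "\<dots> = Abs_fps (\<lambda>n. fps_nth ((\<Sum>l<r. fps_X ^ l) ^ d * (one_minus_X ^ d * ?S)) (r * n))"
    using assms by (intro sections_mult)
  also have "fps_nth \<dots> i = fps_nth (\<Sum>j\<le>d. fps_const (coeff (h_poly \<Delta>) j) *
      ((\<Sum>l<r. fps_X ^ l) ^ d * bary_column d j)) (r * i)"
    unfolding sd_series[OF \<Delta>] by (simp add: sum_distrib_left mult_ac)
  also have "\<dots> = (\<Sum>j\<le>d. H_entry d r i j * coeff (h_poly \<Delta>) j)"
    by (simp add: fps_sum_nth H_entry_def mult.commute)
  finally show "coeff (h_poly \<Delta>') i = (\<Sum>j\<le>d. H_entry d r i j * coeff (h_poly \<Delta>) j)"
    by simp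
qed

section \<open>Spanning \<open>h\<close>-polynomials and uniqueness of the matrix\<close>

text \<open>After extracting \<open>(1 - x)^(d - card A)\<close>, what remains is the expansion of
  \<open>(x + (1 - x))^(card A) = 1\<close>.\<close>

lemma sum_Pow_h_poly:
  assumes "finite A" "card A \<le> d"
  shows "(\<Sum>F\<in>Pow A. monom 1 (card F) * [:1, -1:] ^ (d - card F)) = ([:1, -1:] ^ (d - card A) :: real poly)"
proof -
  let ?q = "[:1, -1:] :: real poly"
  have "(\<Sum>F\<in>Pow A. monom 1 (card F) * ?q ^ (d - card F))
      = (\<Sum>F\<in>Pow A. ?q ^ (d - card A) * ([:0, 1:] ^ card F * ?q ^ (card A - card F)))"
  proof (rule sum.cong)
    fix F assume "F \<in> Pow A"
    then have "card F \<le> card A" using assms(1) by (auto intro: card_mono)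
    then have "d - card F = (d - card A) + (card A - card F)" using assms(2) by simp
    then show "monom 1 (card F) * ?q ^ (d - card F)
        = ?q ^ (d - card A) * ([:0, 1:] ^ card F * ?q ^ (card A - card F))"
      by (simp add: power_add monom_altdef mult_ac)
  qed simp
  also have "\<dots> = ?q ^ (d - card A) * ([:0, 1:] + ?q) ^ card A"
    by (simp only: sum_distrib_left[symmetric] sum_power_card_Pow[OF assms(1)])
  also have "[:0, 1:] + ?q = 1"
    by simp
  finally show ?thesis by simp
qed

text \<open>The first simplex fixes the rank at \<open>d\<close>, while the size
  \<open>k \<le> d\<close> of the second varies the \<open>h\<close>-polynomial.\<close>

definition two_simplices :: "nat \<Rightarrow> nat \<Rightarrow> nat set set" where
  "two_simplices d k = Pow {..<d} \<union> Pow {d..<d + k}"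

lemma two_simplices:
  assumes "k \<le> d"
  shows "simplicial_complex (two_simplices d k)"
    and "rank (two_simplices d k) = d"
    and "h_poly (two_simplices d k) = 1 + [:1, -1:] ^ (d - k) - [:1, -1:] ^ d"
proof -
  show complex: "simplicial_complex (two_simplices d k)"
    by (auto simp: simplicial_complex_def two_simplices_def intro: finite_subset)
  show rank: "rank (two_simplices d k) = d"
  proof (rule rank_eqI[OF complex])
    fix F assume "F \<in> two_simplices d k"
    then show "card F \<le> d"
      using assms card_mono[of "{..<d}" F] card_mono[of "{d..<d + k}" F]
      by (auto simp: two_simplices_def)
  qed (auto simp: two_simplices_def intro: bexI[of _ "{..<d}"])
  let ?g = "\<lambda>F :: nat set. monom 1 (card F) * [:1, -1:] ^ (d - card F) :: real poly"
  have "{..<d} \<inter> {d..<d + k} = {}"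
    by auto
  then have "Pow {..<d} \<inter> Pow {d..<d + k} = {{}}"
    by (simp only: Pow_Int_eq[symmetric] Pow_empty)
  \<comment> \<open>The shared empty face is counted twice; its term is
    \<open>(1 - x)^d\<close>.\<close>
  then have "sum ?g (two_simplices d k) = sum ?g (Pow {..<d}) + sum ?g (Pow {d..<d + k}) - sum ?g {{}}"
    unfolding two_simplices_def by (subst sum_Un) (simp_all only: finite_Pow_iff finite_lessThan finite_atLeastLessThan)
  then have "h_poly (two_simplices d k) = sum ?g (Pow {..<d}) + sum ?g (Pow {d..<d + k}) - sum ?g {{}}"
    by (simp only: h_poly_sum_faces[OF complex] rank)
  then show "h_poly (two_simplices d k) = 1 + [:1, -1:] ^ (d - k) - [:1, -1:] ^ d"
    using assms by (simp add: sum_Pow_h_poly)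
qed

text \<open>The linear functional with coefficients \<open>a\<close> kills all powers
  \<open>(1 - x)^m\<close> with \<open>m \<le> d\<close>, hence also
  \<open>x^j = (1 - (1 - x))^j\<close>, on which its value is \<open>a j\<close>.\<close>

lemma functional_eq_0:
  fixes a :: "nat \<Rightarrow> real"
  assumes zero: "\<And>\<Delta> :: nat set set. simplicial_complex \<Delta> \<Longrightarrow> rank \<Delta> = d \<Longrightarrow>
      (\<Sum>j\<le>d. a j * coeff (h_poly \<Delta>) j) = 0" and "j \<le> d"
  shows "a j = 0"
proof -
  define L where "L p = (\<Sum>j\<le>d. a j * coeff p j)" for p :: "real poly"
  have add: "L (p + q) = L p + L q" and diff: "L (p - q) = L p - L q"
    and smult: "L (smult c p) = c * L p" for p q c
    by (simp_all add: L_def algebra_simps sum.distrib sum_subtractf sum_distrib_left)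
  have L_sum: "L (sum f A) = (\<Sum>x\<in>A. L (f x))" if "finite A" for f and A :: "nat set"
    using that by (induction A rule: finite_induct) (simp_all add: add, simp add: L_def)
  let ?q = "[:1, -1:] :: real poly"
  have key: "L 1 + L (?q ^ (d - k)) - L (?q ^ d) = 0" if "k \<le> d" for k
    using zero[OF two_simplices(1,2)[OF that]]
    by (simp only: two_simplices(3)[OF that] L_def[symmetric] add diff)
  \<comment> \<open>For \<open>k = 0\<close> the two powers cancel; then \<open>k = d\<close> kills
    the top power and \<open>k = d - m\<close> the remaining ones.\<close>
  have "L 1 = 0"
    using key[of 0] by simp
  then have q: "L (?q ^ m) = 0" if "m \<le> d" for m
    using key[of d] key[of "d - m"] that by simp
  have binomial: "(- p + 1) ^ j = (\<Sum>m\<le>j. smult (of_nat (j choose m) * (-1) ^ m) (p ^ m))"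
    for p :: "real poly"
    unfolding binomial_ring
  proof (rule sum.cong)
    fix m
    show "of_nat (j choose m) * (- p) ^ m * 1 ^ (j - m)
        = smult (of_nat (j choose m) * (-1) ^ m) (p ^ m)"
      by (cases "even m") (simp_all add: of_nat_poly)
  qed simp
  have "monom 1 j = (- ?q + 1) ^ j"
    by (simp add: monom_altdef one_pCons)
  also have "\<dots> = (\<Sum>m\<le>j. smult (of_nat (j choose m) * (-1) ^ m) (?q ^ m))"
    by (rule binomial)
  finally have "L (monom 1 j) = (\<Sum>m\<le>j. (of_nat (j choose m) * (-1) ^ m) * L (?q ^ m))"
    by (simp only: L_sum finite_atMost smult)
  also have "\<dots> = 0"
    using q \<open>j \<le> d\<close> by (intro sum.neutral) auto
  finally show "a j = 0"
    using \<open>j \<le> d\<close> by (simp add: L_def if_distrib[of "\<lambda>x. a _ * x"] cong: if_cong)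
qed

lemma complex_dim_eq_iff: "complex_dim \<Delta> = int d - 1 \<longleftrightarrow> rank \<Delta> = d"
  by (auto simp: rank_def complex_dim_def)

text \<open>Ensures that every \<open>\<Delta>\<close> of the right dimension imposes a condition on
  a transformation matrix.\<close>

lemma ex_colored_barycentric:
  assumes "simplicial_complex \<Delta>"
  shows "\<exists>\<Delta>'. colored_barycentric r \<Delta> \<Delta>'"
proof -
  have "finite (\<Union>(sd \<Delta>))"
    using simplicial_complex_sd[OF assms] by (auto simp: simplicial_complex_def)
  then show ?thesis
    using finite_distinct_list by (fastforce simp: colored_barycentric_def)
qed

lemma mult_mat_h_vector:
  assumes "H \<in> carrier_mat (d + 1) (d + 1)" "rank \<Delta> = d" "i \<le> d"
  shows "(H *\<^sub>v h_vector \<Delta>) $ i = (\<Sum>j\<le>d. H $$ (i, j) * coeff (h_poly \<Delta>) j)"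
  using assms
  by (auto simp: h_vector_def rank_def scalar_prod_def lessThan_Suc_atMost atLeast0LessThan
      intro!: sum.cong)

lemma transformation_matrix_colored_barycentric:
  assumes "1 \<le> d" "1 \<le> r"
  shows "transformation_matrix d (colored_barycentric r) = mat (d + 1) (d + 1) (\<lambda>(i, j). H_entry d r i j)"
    (is "_ = ?H")
  unfolding transformation_matrix_def
proof (rule the_equality)
  show "is_transformation_matrix d (colored_barycentric r) ?H"
    unfolding is_transformation_matrix_def complex_dim_eq_iff
  proof (intro conjI allI impI, simp, elim conjE)
    fix \<Delta> :: "nat set set" and \<Delta>'
    assume \<Delta>: "simplicial_complex \<Delta>" "rank \<Delta> = d" "colored_barycentric r \<Delta> \<Delta>'"
    note h = h_poly_colored_barycentric[OF \<Delta>(1,2) assms \<Delta>(3)]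
    show "h_vector \<Delta>' = ?H *\<^sub>v h_vector \<Delta>"
    proof (rule eq_vecI)
      show dim: "dim_vec (h_vector \<Delta>') = dim_vec (?H *\<^sub>v h_vector \<Delta>)"
        using h(1) by (simp add: h_vector_def rank_def)
      fix i assume "i < dim_vec (?H *\<^sub>v h_vector \<Delta>)"
      then have i: "i \<le> d" by simp
      then show "h_vector \<Delta>' $ i = (?H *\<^sub>v h_vector \<Delta>) $ i"
        using h(1) by (subst mult_mat_h_vector[OF _ \<Delta>(2) i])
          (auto simp: h_vector_def rank_def h(2) intro!: sum.cong)
    qed
  qed
next
  fix H :: "real mat"
  assume "is_transformation_matrix d (colored_barycentric r) H"
  then have H: "H \<in> carrier_mat (d + 1) (d + 1)"
    and eq: "\<And>(\<Delta> :: nat set set) \<Delta>'. simplicial_complex \<Delta> \<Longrightarrow> rank \<Delta> = d \<Longrightarrow> colored_barycentric r \<Delta> \<Delta>' \<Longrightarrow>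
      h_vector \<Delta>' = H *\<^sub>v h_vector \<Delta>"
    unfolding is_transformation_matrix_def complex_dim_eq_iff by blast+
  \<comment> \<open>The difference of the two \<open>i\<close>-th rows is a functional vanishing on
    all \<open>h\<close>-vectors.\<close>
  have "H $$ (i, j) - H_entry d r i j = 0" if i: "i \<le> d" and j: "j \<le> d" for i j
  proof (rule functional_eq_0[OF _ j])
    fix \<Delta> :: "nat set set"
    assume \<Delta>: "simplicial_complex \<Delta>" "rank \<Delta> = d"
    obtain \<Delta>' where \<Delta>': "colored_barycentric r \<Delta> \<Delta>'"
      using ex_colored_barycentric[OF \<Delta>(1)] by blast
    note h = h_poly_colored_barycentric[OF \<Delta> assms \<Delta>']
    have "h_vector \<Delta>' $ i = (\<Sum>j\<le>d. H_entry d r i j * coeff (h_poly \<Delta>) j)"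
      using h i by (simp add: h_vector_def rank_def)
    moreover have "h_vector \<Delta>' $ i = (\<Sum>j\<le>d. H $$ (i, j) * coeff (h_poly \<Delta>) j)"
      by (simp only: eq[OF \<Delta> \<Delta>'] mult_mat_h_vector[OF H \<Delta>(2) i])
    ultimately show "(\<Sum>j\<le>d. (H $$ (i, j) - H_entry d r i j) * coeff (h_poly \<Delta>) j) = 0"
      by (simp add: left_diff_distrib sum_subtractf)
  qed
  then show "H = ?H"
    using H by (intro eq_matI) auto
qed

theorem corollary5p7:
  fixes d r :: nat
  assumes "d \<ge> 1" and "r \<ge> 1"
  shows "transformation_matrix d (colored_barycentric r) \<in> carrier_mat (d + 1) (d + 1) \<and>
         TP 2 (transformation_matrix d (colored_barycentric r))"
  unfolding transformation_matrix_colored_barycentric[OF assms]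
  by (simp add: TP_2_mat[OF tp2_H_entry])

end
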